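(* Let $X$ be a separable infinite-dimensional complex Banach space and let $T\in\mathcal{L}(X)$. Suppose that $\Omega(T)$ is non-empty. The following assertions are equivalent: (1) There exists $g\in\mathcal{L}(X)$ such that $\mathrm{R}(T,g)$ is spaceable. (2) For any countable collection $\{g_\ell\}_{\ell\in\mathbb{N}}\subset\Omega(T)$, there exist strictly increasing sequences of positive integers $(\psi_{n,\ell})_n$ ($\ell\in\mathbb{N}$) and an infinite-dimensional closed subspace $M\subset X$ such that $$T^{\psi_{n,\ell}}x\xrightarrow[n\to\infty]{}g_\ell(x)\quad\text{for all }x\in M\text{ and all }\ell\in\mathbb{N}.$$ (3) There exist a strictly increasing sequence of positive integers $(\theta_n)_n$ and an infinite-dimensional closed subspace $E\subset X$ such that $\sup_n\|T^{\theta_n}|_E\|<\infty$. (4) The left essential spectrum of $T$ intersects the closed unit disk.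
   Context: $\mathcal{L}(X)$ is the space of continuous linear operators on $X$. $\Omega(T)$ is the set of all $h\in\mathcal{L}(X)$ for which there is a strictly increasing sequence of positive integers $(\omega_n)_n$ such that $\{x\in X:T^{\omega_n}x\to h(x)\}$ is dense in $X$. For $g\in\mathcal{L}(X)$, $\mathrm{R}(T,g)$ is the set of $x\in X$ for which there is a strictly increasing sequence of positive integers $(\omega_n)_n$ with $T^{\omega_n}x\to g(x)$. A set $A\subset X$ is spaceable if $A\cup\{0\}$ contains an infinite-dimensional closed subspace of $X$. The left essential spectrum of $T$ is the set of $\lambda\in\mathbb{C}$ such that $T-\lambda$ is not left-Fredholm, where $S\in\mathcal{L}(X)$ is called left-Fredholm if $\mathrm{Ran}(S)$ is closed and $\dim\ker(S)<\infty$. *)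

theory Defs
  imports "HOL-Analysis.Analysis"
begin

text \<open>HOL-Analysis only has normed spaces over the reals. A complex normed space is a real one
  carrying a complex scalar multiplication that extends the real one and for which the norm is
  homogeneous.\<close>

class complex_normed_vector = real_normed_vector +
  fixes scaleC :: "complex \<Rightarrow> 'a \<Rightarrow> 'a"  (infixr "*\<^sub>C" 75)
  assumes scaleC_add_right: "a *\<^sub>C (x + y) = a *\<^sub>C x + a *\<^sub>C y"
    and scaleC_add_left: "(a + b) *\<^sub>C x = a *\<^sub>C x + b *\<^sub>C x"
    and scaleC_scaleC: "a *\<^sub>C (b *\<^sub>C x) = (a * b) *\<^sub>C x"
    and scaleC_of_real: "complex_of_real r *\<^sub>C x = r *\<^sub>R x"
    and norm_scaleC: "norm (a *\<^sub>C x) = norm a * norm x"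

class complex_banach = complex_normed_vector + banach

interpretation complex_vector: vector_space "scaleC :: complex \<Rightarrow> 'a::complex_normed_vector \<Rightarrow> 'a"
  by unfold_locales
    (simp_all add: scaleC_add_right scaleC_add_left scaleC_scaleC
      scaleC_of_real[of 1, simplified])

abbreviation csubspace :: "'a::complex_normed_vector set \<Rightarrow> bool"
  where "csubspace \<equiv> module.subspace scaleC"

abbreviation cspan :: "'a::complex_normed_vector set \<Rightarrow> 'a set"
  where "cspan \<equiv> module.span scaleC"

text \<open>The library's dimension function is 0 on infinite-dimensional spaces, so
  finite-dimensionality is expressed by the existence of a finite spanning set.\<close>

definition cfinite_dim :: "'a::complex_normed_vector set \<Rightarrow> bool"
  where "cfinite_dim M \<longleftrightarrow> (\<exists>B. finite B \<and> cspan B = M)"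

definition inf_dim_closed_csubspace :: "'a::complex_normed_vector set \<Rightarrow> bool"
  where "inf_dim_closed_csubspace M \<longleftrightarrow> csubspace M \<and> closed M \<and> \<not> cfinite_dim M"

definition spaceable :: "'a::complex_normed_vector set \<Rightarrow> bool"
  where "spaceable A \<longleftrightarrow> (\<exists>M. inf_dim_closed_csubspace M \<and> M \<subseteq> A \<union> {0})"

definition cont_clinear_ops :: "('a::complex_normed_vector \<Rightarrow> 'a) set"
  where "cont_clinear_ops = {S. Vector_Spaces.linear scaleC scaleC S \<and> continuous_on UNIV S}"

definition pos_strict_mono :: "(nat \<Rightarrow> nat) \<Rightarrow> bool"
  where "pos_strict_mono \<omega> \<longleftrightarrow> strict_mono \<omega> \<and> (\<forall>n. 0 < \<omega> n)"

definition Omega_ops :: "('a::complex_normed_vector \<Rightarrow> 'a) \<Rightarrow> ('a \<Rightarrow> 'a) set"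
  where "Omega_ops T = {h \<in> cont_clinear_ops. \<exists>\<omega>. pos_strict_mono \<omega> \<and>
    closure {x. (\<lambda>n. (T ^^ \<omega> n) x) \<longlonglongrightarrow> h x} = UNIV}"

definition R_set :: "('a::complex_normed_vector \<Rightarrow> 'a) \<Rightarrow> ('a \<Rightarrow> 'a) \<Rightarrow> 'a set"
  where "R_set T g = {x. \<exists>\<omega>. pos_strict_mono \<omega> \<and> (\<lambda>n. (T ^^ \<omega> n) x) \<longlonglongrightarrow> g x}"

text \<open>Operator norm of the restriction of \<open>S\<close> to \<open>E\<close>, analogous to the library's \<open>onorm\<close>
  (the point 0 contributes 0, as division by 0 yields 0).\<close>

definition onorm_on :: "'a::complex_normed_vector set \<Rightarrow> ('a \<Rightarrow> 'a) \<Rightarrow> real"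
  where "onorm_on E S = (SUP x\<in>E. norm (S x) / norm x)"

definition left_Fredholm :: "('a::complex_normed_vector \<Rightarrow> 'a) \<Rightarrow> bool"
  where "left_Fredholm S \<longleftrightarrow> closed (range S) \<and> cfinite_dim {x. S x = 0}"

definition left_essential_spectrum :: "('a::complex_normed_vector \<Rightarrow> 'a) \<Rightarrow> complex set"
  where "left_essential_spectrum T = {z. \<not> left_Fredholm (\<lambda>x. T x - z *\<^sub>C x)}"

end

theory Submission
  imports Defs
begin

text \<open>
  The implications proved are \<open>A4 \<Longrightarrow> A2\<close>, \<open>A4 \<Longrightarrow> A3\<close>, \<open>A2 \<Longrightarrow> A1\<close>, \<open>A1 \<Longrightarrow> A4\<close> and \<open>A3 \<Longrightarrow> A4\<close>. Since
  \<open>Omega_ops T\<close> contains some \<open>h\<close>, \<open>A2\<close> for the family that is constantly \<open>h\<close> gives \<open>A1\<close>.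

  For the steps from \<open>A4\<close>, let \<open>\<bar>z\<bar> \<le> 1\<close> be such that \<open>T - z\<close> is not left Fredholm. Then \<open>T - z\<close> has
  arbitrarily small values on unit vectors of \<open>D \<inter> L\<close>, for each closed subspace \<open>L\<close> that is the
  joint kernel of finitely many functionals and each dense subspace \<open>D\<close>
  (\<open>not_left_Fredholm_small_vector\<close>). A Baire category argument in the space of all sequences of
  vectors yields one dense \<open>D\<close> on which a subsequence of the powers of \<open>T\<close> converges to \<open>g l\<close>, for every \<open>l\<close>
  (\<open>common_dense_subspace\<close>). A recursion in the style of Mazur then selects in \<open>D\<close> a normalised basic sequence
  \<open>e\<close> together with exponents \<open>p k\<close>, the indices \<open>l\<close> being visited infinitely often, such that
  \<open>T ^^ p k\<close> is close to the \<open>k\<close>-th limit operator on \<open>e 0, ..., e k\<close> and close to the scalar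
  \<open>z ^ p k\<close>, which has modulus at most 1, on all later \<open>e j\<close> (\<open>adapted_basic_sequence\<close>). On the closed
  span of \<open>e\<close> the powers in question are therefore uniformly bounded and converge
  (\<open>common_convergence_subspace\<close>).

  For the steps to \<open>A4\<close>, suppose that \<open>T - z\<close> is left Fredholm for all \<open>\<bar>z\<bar> \<le> 1\<close>. By compactness of
  the disk, \<open>T - z\<close> is bounded below by one constant \<open>c\<close> on one subspace \<open>V\<close> of finite codimension, for
  all these \<open>z\<close> (\<open>uniform_bounded_below\<close>). With \<open>q = (T ^^ L - z ^ L) / (T - z)\<close>, a polynomial in \<open>T\<close> and \<open>z\<close>,
  the inequality
  \<open>c\<^sup>2 * \<parallel>q\<^sup>2 x\<parallel> \<le> \<parallel>(T - z)\<^sup>2 q\<^sup>2 x\<parallel> = \<parallel>(T ^^ L - z ^ L)\<^sup>2 x\<parallel>\<close>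
  holds as long as the orbit of \<open>x\<close> stays in \<open>V\<close>. The coefficient of \<open>z ^ (L - 1)\<close> in \<open>q\<^sup>2\<close> is \<open>L\<close> times
  \<open>T ^^ (L - 1)\<close>, so Cauchy's estimate on circles gives, for \<open>L\<close> large and \<open>U = T ^^ L\<close>,
  the inequality \<open>4 * \<sigma> * \<parallel>U x\<parallel> \<le> \<parallel>U\<^sup>2 x\<parallel> + \<sigma>\<^sup>2 * \<parallel>x\<parallel>\<close> for \<open>0 \<le> \<sigma> \<le> 1\<close>.
  This forces the ratios \<open>\<parallel>U ^^ (k + 1) x\<parallel> / \<parallel>U ^^ k x\<parallel>\<close> to grow geometrically until they reach 2
  (\<open>ratio_growth\<close>), whence exponential growth of orbits on subspaces of finite codimension
  (\<open>funpow_growth_finite_codim\<close>). In each infinite-dimensional closed subspace a gliding hump then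
  produces one vector whose orbit tends to infinity in norm (\<open>orbit_tends_to_infinity\<close>), which
  contradicts both \<open>A1\<close> and \<open>A3\<close>.

  The functional analysis needed along the way is a Hahn--Banach theorem (\<open>norming_functional\<close>), the fact
  that finitely many functionals norm a finite-dimensional space up to a constant
  (\<open>finite_dim_norming\<close>) and a form of the open mapping theorem (\<open>closed_range_bounded_preimage\<close>).
\<close>

section \<open>Bounded complex-linear maps\<close>

text \<open>The scalars form a complex Banach space, so that functionals and operators are instances of one
  notion of bounded complex-linear map.\<close>

instantiation complex :: complex_banach
begin
definition scaleC_complex :: "complex \<Rightarrow> complex \<Rightarrow> complex"
  where "scaleC_complex = (*)"
instance
  by standard
    (simp_all add: scaleC_complex_def algebra_simps norm_mult scaleR_conv_of_real)
end

lemma bounded_bilinear_scaleC: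
  "bounded_bilinear (scaleC :: complex \<Rightarrow> 'a::complex_normed_vector \<Rightarrow> 'a)"
proof
  fix a a' :: complex and b b' :: 'a and r :: real
  show "(a + a') *\<^sub>C b = a *\<^sub>C b + a' *\<^sub>C b" by (rule scaleC_add_left)
  show "a *\<^sub>C (b + b') = a *\<^sub>C b + a *\<^sub>C b'" by (rule scaleC_add_right)
  show "(r *\<^sub>R a) *\<^sub>C b = r *\<^sub>R (a *\<^sub>C b)"
    by (metis scaleC_of_real scaleC_scaleC scaleR_conv_of_real)
  show "a *\<^sub>C (r *\<^sub>R b) = r *\<^sub>R (a *\<^sub>C b)"
    by (metis scaleC_of_real scaleC_scaleC mult.commute)
  show "\<exists>K. \<forall>a (b::'a). norm (a *\<^sub>C b) \<le> norm a * norm b * K"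
    by (rule exI[of _ 1]) (simp add: norm_scaleC)
qed

lemmas tendsto_scaleC = bounded_bilinear.tendsto[OF bounded_bilinear_scaleC]
lemmas continuous_on_scaleC = bounded_bilinear.continuous_on[OF bounded_bilinear_scaleC]

text \<open>Bounded complex-linear maps, as bounded real-linear maps that commute with complex scalars; this
  makes the library of real bounded linear maps applicable.\<close>

definition bounded_clinear :: "('a::complex_normed_vector \<Rightarrow> 'b::complex_normed_vector) \<Rightarrow> bool"
  where "bounded_clinear S \<longleftrightarrow> bounded_linear S \<and> (\<forall>c x. S (c *\<^sub>C x) = c *\<^sub>C S x)"

lemma bounded_clinear_bounded_linear: "bounded_clinear S \<Longrightarrow> bounded_linear S"
  and bounded_clinear_scaleC: "bounded_clinear S \<Longrightarrow> S (c *\<^sub>C x) = c *\<^sub>C S x"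
  by (simp_all add: bounded_clinear_def)

lemma bounded_clinear_linear: "bounded_clinear S \<Longrightarrow> linear S"
  by (simp add: bounded_clinear_bounded_linear bounded_linear.linear)

lemmas bounded_clinear_add = linear_add[OF bounded_clinear_linear]
  and bounded_clinear_diff = linear_diff[OF bounded_clinear_linear]
  and bounded_clinear_zero = linear_0[OF bounded_clinear_linear]
  and bounded_clinear_sum = linear_sum[OF bounded_clinear_linear]
  and bounded_clinear_bounded = bounded_linear.pos_bounded[OF bounded_clinear_bounded_linear]
  and bounded_clinear_tendsto = bounded_linear.tendsto[OF bounded_clinear_bounded_linear]
  and bounded_clinear_continuous_on =
    bounded_linear.continuous_on[OF bounded_clinear_bounded_linear continuous_on_id]

lemma cont_clinear_ops_iff: "S \<in> cont_clinear_ops \<longleftrightarrow> bounded_clinear S"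
proof
  assume S: "S \<in> cont_clinear_ops"
  then interpret S: Vector_Spaces.linear scaleC scaleC S
    by (simp add: cont_clinear_ops_def)
  have cont: "isCont S 0"
    using S by (simp add: cont_clinear_ops_def continuous_on_eq_continuous_at)
  have lin: "linear S"
    by (rule linearI) (simp_all add: S.add S.scale flip: scaleC_of_real)
  obtain d where d: "d > 0" "\<And>x. norm x < d \<Longrightarrow> norm (S x) < 1"
    using cont[unfolded continuous_at_eps_delta, rule_format, of 1]
    by (auto simp: dist_norm S.zero)
  have "norm (S x) \<le> norm x * (2 / d)" for x
  proof (cases "x = 0")
    case False
    have "norm (S ((d / (2 * norm x)) *\<^sub>R x)) < 1"
      using d(1) False by (intro d(2)) simp
    then have "d / (2 * norm x) * norm (S x) < 1"
      using d(1) by (simp add: linear_scale[OF lin])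
    then show ?thesis
      using d(1) False by (simp add: field_simps)
  qed (simp add: S.zero)
  then have "bounded_linear S"
    using lin by (intro bounded_linear_intro[of _ "2 / d"]) (simp_all add: linear_add linear_scale)
  then show "bounded_clinear S"
    by (simp add: bounded_clinear_def S.scale)
next
  assume S: "bounded_clinear S"
  have "Vector_Spaces.linear scaleC scaleC S"
    by unfold_locales (simp_all add: bounded_clinear_add[OF S] bounded_clinear_scaleC[OF S] scaleC_add_right scaleC_add_left scaleC_scaleC scaleC_of_real[of 1, simplified])
  then show "S \<in> cont_clinear_ops"
    by (simp add: cont_clinear_ops_def bounded_clinear_continuous_on[OF S])
qed

lemma bounded_clinear_intro:
  assumes "\<And>x y. S (x + y) = S x + S y" and c: "\<And>c x. S (c *\<^sub>C x) = c *\<^sub>C S x"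
    and "\<And>x. norm (S x) \<le> norm x * K"
  shows "bounded_clinear S"
proof -
  have "S (r *\<^sub>R x) = r *\<^sub>R S x" for r x
    using c[of "complex_of_real r" x] by (simp add: scaleC_of_real)
  then show ?thesis
    unfolding bounded_clinear_def using assms by (blast intro: bounded_linear_intro)
qed

lemma bounded_clinear_id: "bounded_clinear (\<lambda>x. x)"
  by (simp add: bounded_clinear_def)

lemma bounded_clinear_scaleC_right: "bounded_clinear (\<lambda>x. c *\<^sub>C x)"
  by (rule bounded_clinear_intro[of _ "norm c"])
    (simp_all add: scaleC_add_right scaleC_scaleC norm_scaleC mult.commute)

lemma bounded_clinear_compose:
  assumes "bounded_clinear S" "bounded_clinear R"
  shows "bounded_clinear (\<lambda>x. S (R x))"
  using assms by (simp add: bounded_clinear_def bounded_linear_compose)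

lemma bounded_clinear_diff_op:
  assumes "bounded_clinear S" "bounded_clinear R"
  shows "bounded_clinear (\<lambda>x. S x - R x)"
  using assms by (simp add: bounded_clinear_def bounded_linear_sub complex_vector.scale_right_diff_distrib)

lemma bounded_clinear_funpow:
  fixes T :: "'a::complex_normed_vector \<Rightarrow> 'a"
  assumes "bounded_clinear T"
  shows "bounded_clinear (T ^^ n)"
proof (induction n)
  case 0
  show ?case using bounded_clinear_id by (simp add: id_def)
next
  case (Suc n)
  then show ?case
    using bounded_clinear_compose[OF assms Suc.IH] by (simp add: comp_def)
qed

section \<open>The Hahn--Banach theorem\<close>

text \<open>Sublinear functionals: subadditive and positively homogeneous.\<close>

definition sublinear :: "('a::real_vector \<Rightarrow> real) \<Rightarrow> bool"
  where "sublinear q \<longleftrightarrow> (\<forall>x y. q (x + y) \<le> q x + q y) \<and> (\<forall>r\<ge>0. \<forall>x. q (r *\<^sub>R x) = r * q x)"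

lemma sublinear_zero:
  assumes "sublinear q" shows "q 0 = 0"
proof -
  have "q (0 *\<^sub>R 0) = 0 * q 0" using assms unfolding sublinear_def by blast
  then show ?thesis by simp
qed

lemma sublinear_neg_le:
  assumes "sublinear q" shows "- q (- x) \<le> q x"
proof -
  have "q (x + - x) \<le> q x + q (- x)" using assms unfolding sublinear_def by blast
  then show ?thesis using sublinear_zero[OF assms] by simp
qed

text \<open>The infimum of \<open>q\<close> along the ray in direction \<open>v\<close>, corrected by the growth of \<open>q\<close> on that ray, is again
  sublinear. It is the device both for showing that minimal sublinear functionals are linear and for
  prescribing the value of a functional at a given point.\<close>

lemma sublinear_descent:
  fixes q :: "'a::real_vector \<Rightarrow> real" and v :: 'a
  assumes q: "sublinear q"
  defines "q' \<equiv> \<lambda>y. INF t\<in>{0..}. q (y + t *\<^sub>R v) - t * q v"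
  shows "sublinear q'" and "\<And>t y. t \<ge> 0 \<Longrightarrow> q' y \<le> q (y + t *\<^sub>R v) - t * q v"
proof -
  have add: "q (x + y) \<le> q x + q y" for x y
    using q by (simp add: sublinear_def)
  have hom: "q (r *\<^sub>R x) = r * q x" if "r \<ge> 0" for r x
    using q that by (simp add: sublinear_def)
  have lower: "- q (- y) \<le> q (y + t *\<^sub>R v) - t * q v" if "t \<ge> 0" for t y
    using add[of "y + t *\<^sub>R v" "- y"] hom[OF that, of v] by simp
  have bdd: "bdd_below ((\<lambda>t. q (y + t *\<^sub>R v) - t * q v) ` {0..})" for y
    using lower[of _ y] by (intro bdd_belowI2[where m = "- q (- y)"]) simp
  show le: "q' y \<le> q (y + t *\<^sub>R v) - t * q v" if "t \<ge> 0" for t y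
    unfolding q'_def using that by (intro cINF_lower[OF bdd]) simp
  have ge: "c \<le> q' y" if "\<And>t. t \<ge> 0 \<Longrightarrow> c \<le> q (y + t *\<^sub>R v) - t * q v" for c y
    unfolding q'_def using that by (intro cINF_greatest) auto
  have "q' (x + y) \<le> q' x + q' y" for x y
  proof -
    have "q' (x + y) - (q (y + s *\<^sub>R v) - s * q v) \<le> q' x" if "s \<ge> 0" for s
    proof (rule ge)
      fix t :: real assume "t \<ge> 0"
      have "q' (x + y) \<le> q ((x + t *\<^sub>R v) + (y + s *\<^sub>R v)) - (t + s) * q v"
        using le[of "t + s" "x + y"] \<open>t \<ge> 0\<close> \<open>s \<ge> 0\<close> by (simp add: algebra_simps)
      also have "\<dots> \<le> q (x + t *\<^sub>R v) + q (y + s *\<^sub>R v) - (t + s) * q v"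
        using add by simp
      finally show "q' (x + y) - (q (y + s *\<^sub>R v) - s * q v) \<le> q (x + t *\<^sub>R v) - t * q v"
        by (simp add: algebra_simps)
    qed
    then have "q' (x + y) - q' x \<le> q' y"
      by (intro ge) (simp add: algebra_simps)
    then show ?thesis by simp
  qed
  moreover have half: "r * q' x \<le> q' (r *\<^sub>R x)" if "r > 0" for r x
  proof (rule ge)
    fix t :: real assume "t \<ge> 0"
    have "r * q' x \<le> r * (q (x + (t / r) *\<^sub>R v) - (t / r) * q v)"
      using that \<open>t \<ge> 0\<close> by (intro mult_left_mono le) simp_all
    also have "\<dots> = q (r *\<^sub>R (x + (t / r) *\<^sub>R v)) - t * q v"
      using that by (subst hom) (simp_all add: algebra_simps)
    also have "\<dots> = q (r *\<^sub>R x + t *\<^sub>R v) - t * q v"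
      using that by (simp add: algebra_simps)
    finally show "r * q' x \<le> q (r *\<^sub>R x + t *\<^sub>R v) - t * q v" .
  qed
  moreover have "q' (r *\<^sub>R x) = r * q' x" if "r > 0" for r x
  proof (rule antisym)
    have "inverse r * q' (r *\<^sub>R x) \<le> q' x"
      using half[of "inverse r" "r *\<^sub>R x"] that by simp
    then show "q' (r *\<^sub>R x) \<le> r * q' x"
      using that by (simp add: field_simps)
  qed (rule half[OF that])
  moreover have "q' 0 = 0"
  proof (rule antisym)
    show "q' 0 \<le> 0" using le[of 0 0] sublinear_zero[OF q] by simp
    show "0 \<le> q' 0" using hom by (intro ge) simp
  qed
  ultimately show "sublinear q'"
    unfolding sublinear_def by (metis linorder_cases mult_zero_left not_less scaleR_zero_left)
qed

text \<open>By Zorn's lemma there is a minimal sublinear functional below \<open>p\<close>; replacing it by its descent along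
  an arbitrary direction cannot make it smaller, which forces additivity.\<close>

lemma sublinear_minorant_linear:
  fixes p :: "'a::real_vector \<Rightarrow> real"
  assumes p: "sublinear p"
  obtains q where "linear q" "\<And>y. q y \<le> p y"
proof -
  define A where "A = {q. sublinear q \<and> q \<le> p}"
  have "\<exists>m\<in>A. \<forall>a\<in>A. m \<ge> a \<longrightarrow> a = m"
  proof (rule predicate_Zorn)
    show "partial_order_on A (relation_of (\<ge>) A)"
      by (rule partial_order_on_relation_ofI) auto
    fix C assume C: "C \<in> Chains (relation_of (\<ge>) A)"
    then have CA: "C \<subseteq> A" and lin: "\<And>f g. f \<in> C \<Longrightarrow> g \<in> C \<Longrightarrow> f \<le> g \<or> g \<le> f"
      by (auto simp: Chains_def relation_of_def)
    show "\<exists>u\<in>A. \<forall>a\<in>C. a \<ge> u"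
    proof (cases "C = {}")
      case True
      then show ?thesis using p by (auto simp: A_def)
    next
      case False
      define u where "u y = (INF q\<in>C. q y)" for y
      have "- p (- y) \<le> q y" if "q \<in> C" for q y
      proof -
        have "sublinear q" "q (- y) \<le> p (- y)" using that CA by (auto simp: A_def le_fun_def)
        then show ?thesis using sublinear_neg_le[of q y] by linarith
      qed
      then have bdd: "bdd_below ((\<lambda>q. q y) ` C)" for y
        by (intro bdd_belowI2[where m = "- p (- y)"])
      have le: "u y \<le> q y" if "q \<in> C" for q y
        unfolding u_def by (rule cINF_lower[OF bdd that])
      have ge: "c \<le> u y" if "\<And>q. q \<in> C \<Longrightarrow> c \<le> q y" for c y
        unfolding u_def using that False by (intro cINF_greatest) auto
      have sub: "sublinear q" if "q \<in> C" for q using that CA by (auto simp: A_def)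
      have "u (x + y) \<le> u x + u y" for x y
      proof -
        have "u (x + y) - g y \<le> f x" if fg: "f \<in> C" "g \<in> C" for f g
        proof -
          obtain h where "h \<in> C" "h \<le> f" "h \<le> g"
            using lin[OF fg] fg by blast
          moreover have "h (x + y) \<le> h x + h y"
            using sub[OF \<open>h \<in> C\<close>] by (simp add: sublinear_def)
          ultimately show ?thesis
            using le[OF \<open>h \<in> C\<close>, of "x + y"] by (smt (verit) le_funD)
        qed
        then have "u (x + y) - g y \<le> u x" if "g \<in> C" for g
          using that ge by blast
        then have "u (x + y) - u x \<le> u y"
          by (intro ge) (simp add: algebra_simps)
        then show ?thesis by simp
      qed
      moreover have "u (r *\<^sub>R x) = r * u x" if "r \<ge> 0" for r x
      proof (cases "r = 0")
        case True
        have "u 0 = (INF q\<in>C. 0)"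
          unfolding u_def using sub sublinear_zero by (intro INF_cong) auto
        then show ?thesis using True False by simp
      next
        case r: False
        have h: "q (r *\<^sub>R x) = r * q x" if "q \<in> C" for q
          using sub[OF that] \<open>r \<ge> 0\<close> by (simp add: sublinear_def)
        have "u (r *\<^sub>R x) / r \<le> u x"
        proof (rule ge)
          fix q assume "q \<in> C"
          then have "u (r *\<^sub>R x) \<le> r * q x" using le[of q "r *\<^sub>R x"] h by simp
          then show "u (r *\<^sub>R x) / r \<le> q x" using r that by (simp add: field_simps)
        qed
        moreover have "r * u x \<le> u (r *\<^sub>R x)"
        proof (rule ge)
          fix q assume "q \<in> C"
          then show "r * u x \<le> q (r *\<^sub>R x)" using mult_left_mono[OF le[of q x] that] h by simp
        qed
        ultimately show ?thesis
          using r that by (simp add: field_simps)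
      qed
      moreover have "u \<le> p"
      proof (rule le_funI)
        fix y
        obtain q where "q \<in> C" using False by blast
        moreover from this have "q y \<le> p y" using CA by (auto simp: A_def le_fun_def)
        ultimately show "u y \<le> p y" using le[of q y] by linarith
      qed
      ultimately have "u \<in> A" by (simp add: A_def sublinear_def)
      then show ?thesis using le by (auto simp: le_fun_def)
    qed
  qed
  then obtain q where q: "q \<in> A" and min: "\<And>a. a \<in> A \<Longrightarrow> a \<le> q \<Longrightarrow> a = q" by blast
  have sq: "sublinear q" and qp: "q \<le> p" using q by (auto simp: A_def)
  have add: "q (y + v) = q y + q v" for y v
  proof -
    define q' where "q' = (\<lambda>y. INF t\<in>{0..}. q (y + t *\<^sub>R v) - t * q v)"
    have le: "q' y \<le> q (y + t *\<^sub>R v) - t * q v" if "t \<ge> 0" for t y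
      unfolding q'_def by (rule sublinear_descent(2)[OF sq that])
    have "sublinear q'"
      unfolding q'_def by (rule sublinear_descent(1)[OF sq])
    moreover have "q' y \<le> q y" for y using le[of 0 y] by simp
    then have "q' \<le> q" by (simp add: le_fun_def)
    ultimately have "q' = q" using qp by (intro min) (auto simp: A_def)
    then have "q y + q v \<le> q (y + v)" using le[of 1 y] by simp
    moreover have "q (y + v) \<le> q y + q v" using sq by (simp add: sublinear_def)
    ultimately show ?thesis by (rule antisym[rotated])
  qed
  have neg: "q (- y) = - q y" for y
    using add[of y "- y"] sublinear_zero[OF sq] by simp
  have pos: "q (r *\<^sub>R y) = r * q y" if "r \<ge> 0" for r y
    using sq that by (simp add: sublinear_def)
  have "q (r *\<^sub>R y) = r * q y" for r y
    using pos[of r y] pos[of "- r" y] neg[of "r *\<^sub>R y"] by (cases "r \<ge> 0") simp_all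
  then have "linear q" by (intro linearI) (simp_all add: add)
  then show ?thesis using qp that by (auto simp: le_fun_def)
qed

text \<open>The Hahn--Banach theorem in the form used below. A real functional \<open>q\<close> of norm at most 1
  with \<open>q x = norm x\<close> is complexified to \<open>y \<mapsto> q y - \<i> * q (\<i> y)\<close>; the crude norm bound 2 suffices.\<close>

lemma norming_functional:
  fixes x :: "'a::complex_normed_vector"
  obtains \<phi> :: "'a \<Rightarrow> complex"
  where "bounded_clinear \<phi>" "\<And>y. norm (\<phi> y) \<le> 2 * norm y" "Re (\<phi> x) = norm x"
proof -
  have sn: "sublinear (norm :: 'a \<Rightarrow> real)"
    by (simp add: sublinear_def norm_triangle_ineq)
  define p where "p = (\<lambda>y. INF t\<in>{0..}. norm (y + t *\<^sub>R x) - t * norm x)"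
  have sp: "sublinear p"
    unfolding p_def by (rule sublinear_descent(1)[OF sn])
  have p: "p y \<le> norm (y + t *\<^sub>R x) - t * norm x" if "t \<ge> 0" for t y
    unfolding p_def by (rule sublinear_descent(2)[OF sn that])
  obtain q where lin: "linear q" and qp: "\<And>y. q y \<le> p y"
    using sublinear_minorant_linear[OF sp] by blast
  have le: "q y \<le> norm y" for y
    using qp[of y] p[of 0 y] by simp
  have abs: "\<bar>q y\<bar> \<le> norm y" for y
    using le[of y] le[of "- y"] linear_neg[OF lin, of y] by simp
  have "q (- x) \<le> - norm x"
    using qp[of "- x"] p[of 1 "- x"] by simp
  then have qx: "q x = norm x"
    using le[of x] linear_neg[OF lin, of x] by simp
  define \<phi> where "\<phi> y = Complex (q y) (- q (\<i> *\<^sub>C y))" for y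
  have qc: "q (c *\<^sub>C y) = Re c * q y + Im c * q (\<i> *\<^sub>C y)" for c y
  proof -
    have "c *\<^sub>C y = Re c *\<^sub>R y + Im c *\<^sub>R (\<i> *\<^sub>C y)"
      by (metis complex_eq scaleC_add_left scaleC_of_real scaleC_scaleC mult.commute)
    then show ?thesis by (simp add: linear_add[OF lin] linear_scale[OF lin])
  qed
  have bound: "norm (\<phi> y) \<le> 2 * norm y" for y
    using cmod_le[of "\<phi> y"] abs[of y] abs[of "\<i> *\<^sub>C y"] by (simp add: \<phi>_def norm_scaleC)
  have "bounded_clinear \<phi>"
  proof (rule bounded_clinear_intro[of _ 2])
    show "\<phi> (y + z) = \<phi> y + \<phi> z" for y z
      by (simp add: \<phi>_def complex_eq_iff scaleC_add_right linear_add[OF lin])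
    show "\<phi> (c *\<^sub>C y) = c *\<^sub>C \<phi> y" for c y
      using qc[of c y] qc[of "\<i> * c" y]
      by (simp add: \<phi>_def complex_eq_iff scaleC_complex_def scaleC_scaleC)
    show "norm (\<phi> y) \<le> norm y * 2" for y using bound[of y] by simp
  qed
  then show ?thesis using that[of \<phi>] bound qx by (simp add: \<phi>_def)
qed

section \<open>Finite-dimensional and finite-codimensional subspaces\<close>

lemma csubspaceI:
  assumes "0 \<in> V" "\<And>x y. x \<in> V \<Longrightarrow> y \<in> V \<Longrightarrow> x + y \<in> V" "\<And>c x. x \<in> V \<Longrightarrow> c *\<^sub>C x \<in> V"
  shows "csubspace V"
  using assms by (rule complex_vector.subspaceI)

lemma csubspace_closure:
  assumes "csubspace V"
  shows "csubspace (closure V)"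
proof (rule csubspaceI)
  show "0 \<in> closure V"
    using complex_vector.subspace_0[OF assms] closure_subset by blast
next
  fix x y assume "x \<in> closure V" "y \<in> closure V"
  then obtain f g where "\<And>n. f n \<in> V" "f \<longlonglongrightarrow> x" "\<And>n. g n \<in> V" "g \<longlonglongrightarrow> y"
    unfolding closure_sequential by metis
  then show "x + y \<in> closure V"
    unfolding closure_sequential
    by (intro exI[of _ "\<lambda>n. f n + g n"]) (auto intro: tendsto_add complex_vector.subspace_add[OF assms])
next
  fix c x assume "x \<in> closure V"
  then obtain f where "\<And>n. f n \<in> V" "f \<longlonglongrightarrow> x"
    unfolding closure_sequential by metis
  then show "c *\<^sub>C x \<in> closure V"
    unfolding closure_sequential
    by (intro exI[of _ "\<lambda>n. c *\<^sub>C f n"])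
      (auto intro: tendsto_scaleC complex_vector.subspace_scale[OF assms])
qed

lemma norm_line_coefficient_le:
  assumes F: "csubspace F" "closed F" and e: "e \<notin> F"
  obtains d where "d > 0" "\<And>u a. u \<in> F \<Longrightarrow> norm a * d \<le> norm (u + a *\<^sub>C e)"
proof -
  have F0: "0 \<in> F" using complex_vector.subspace_0[OF F(1)] .
  define d where "d = infdist e F"
  have "d > 0"
    using in_closed_iff_infdist_zero[OF F(2)] F0 e infdist_nonneg[of e F] by (force simp: d_def)
  moreover have "norm a * d \<le> norm (u + a *\<^sub>C e)" if "u \<in> F" for u a
  proof (cases "a = 0")
    case False
    have "- inverse a *\<^sub>C u \<in> F" using F(1) that by (rule complex_vector.subspace_scale)
    then have "d \<le> norm (e - (- inverse a *\<^sub>C u))"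
      using infdist_le[of "- inverse a *\<^sub>C u" F e] by (simp add: d_def dist_norm)
    then have "norm a * d \<le> norm (a *\<^sub>C (e - (- inverse a *\<^sub>C u)))"
      by (simp add: norm_scaleC mult_left_mono)
    also have "a *\<^sub>C (e - (- inverse a *\<^sub>C u)) = u + a *\<^sub>C e"
      using False by (simp add: scaleC_add_right scaleC_scaleC scaleC_of_real[of 1, simplified] add.commute)
    finally show ?thesis .
  qed simp
  ultimately show ?thesis using that by blast
qed

lemma closed_csubspace_plus_line:
  fixes F :: "'a::complex_banach set"
  assumes F: "csubspace F" "closed F"
  shows "closed {u + a *\<^sub>C e | u a. u \<in> F}"
proof (cases "e \<in> F")
  case True
  have "{u + a *\<^sub>C e | u a. u \<in> F} = F"
  proof
    show "{u + a *\<^sub>C e | u a. u \<in> F} \<subseteq> F"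
      using True F(1) by (auto intro!: complex_vector.subspace_add complex_vector.subspace_scale)
    show "F \<subseteq> {u + a *\<^sub>C e | u a. u \<in> F}"
      by (force intro: exI[of _ "0::complex"])
  qed
  then show ?thesis using F(2) by simp
next
  case False
  obtain d where d: "d > 0" "\<And>u a. u \<in> F \<Longrightarrow> norm a * d \<le> norm (u + a *\<^sub>C e)"
    using norm_line_coefficient_le[OF F False] by blast
  show ?thesis
    unfolding closed_sequential_limits
  proof (intro allI impI, elim conjE)
    fix f l assume f: "\<forall>n. f n \<in> {u + a *\<^sub>C e | u a. u \<in> F}" and lim: "f \<longlonglongrightarrow> l"
    then obtain u a where ua: "\<And>n. u n \<in> F" "\<And>n. f n = u n + a n *\<^sub>C e"
      unfolding mem_Collect_eq by metis
    have "Cauchy f" using lim by (rule LIMSEQ_imp_Cauchy)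
    have "dist (a m) (a n) * d \<le> dist (f m) (f n)" for m n
    proof -
      have "u m - u n \<in> F" using ua F(1) by (simp add: complex_vector.subspace_diff)
      from d(2)[OF this, of "a m - a n"] show ?thesis
        by (simp add: ua dist_norm complex_vector.scale_left_diff_distrib algebra_simps)
    qed
    note * = this
    have "Cauchy a"
    proof (rule metric_CauchyI)
      fix r :: real assume "r > 0"
      then obtain N where N: "\<And>m n. m \<ge> N \<Longrightarrow> n \<ge> N \<Longrightarrow> dist (f m) (f n) < r * d"
        using metric_CauchyD[OF \<open>Cauchy f\<close>, of "r * d"] d(1) by auto
      have "dist (a m) (a n) < r" if "m \<ge> N" "n \<ge> N" for m n
        using *[of m n] N[OF that] d(1) by (meson le_less_trans mult_less_cancel_right_pos)
      then show "\<exists>M. \<forall>m\<ge>M. \<forall>n\<ge>M. dist (a m) (a n) < r" by blast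
    qed
    then obtain b where b: "a \<longlonglongrightarrow> b" using Cauchy_convergent_iff convergent_def by blast
    have "(\<lambda>n. f n - a n *\<^sub>C e) \<longlonglongrightarrow> l - b *\<^sub>C e"
      by (intro tendsto_diff lim tendsto_scaleC b tendsto_const)
    moreover have "(\<lambda>n. f n - a n *\<^sub>C e) = u" by (simp add: ua)
    ultimately have "l - b *\<^sub>C e \<in> F"
      using F(2) ua(1) unfolding closed_sequential_limits by metis
    then show "l \<in> {u + a *\<^sub>C e | u a. u \<in> F}"
      by (auto intro!: exI[of _ "l - b *\<^sub>C e"] exI[of _ b])
  qed
qed

lemma cspan_insert_eq: "cspan (insert e B) = {u + a *\<^sub>C e | u a. u \<in> cspan B}"
proof -
  have "x \<in> cspan (insert e B) \<longleftrightarrow> (\<exists>u a. x = u + a *\<^sub>C e \<and> u \<in> cspan B)" for x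
    unfolding complex_vector.span_breakdown_eq
  proof
    assume "\<exists>k. x - k *\<^sub>C e \<in> cspan B"
    then obtain k where "x - k *\<^sub>C e \<in> cspan B" ..
    then show "\<exists>u a. x = u + a *\<^sub>C e \<and> u \<in> cspan B"
      by (intro exI[of _ "x - k *\<^sub>C e"] exI[of _ k]) simp
  next
    assume "\<exists>u a. x = u + a *\<^sub>C e \<and> u \<in> cspan B"
    then obtain u a where "x = u + a *\<^sub>C e" "u \<in> cspan B" by blast
    then show "\<exists>k. x - k *\<^sub>C e \<in> cspan B" by (intro exI[of _ a]) simp
  qed
  then show ?thesis by blast
qed

text \<open>Finite-dimensional subspaces are closed, by adding one line at a time.\<close>

lemma closed_cspan_finite:
  fixes B :: "'a::complex_banach set"
  assumes "finite B"
  shows "closed (cspan B)"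
  using assms
proof (induction B)
  case (insert e B)
  then show ?case
    unfolding cspan_insert_eq
    by (intro closed_csubspace_plus_line complex_vector.subspace_span)
qed simp

text \<open>Adding a vector \<open>e\<close> outside the closed subspace spanned so far keeps the coefficient of \<open>e\<close> bounded by
  the norm, so a ball of the larger space lies in a continuous image of a product of compact sets.\<close>

lemma compact_cspan_finite:
  fixes B :: "'a::complex_banach set"
  assumes "finite B"
  shows "compact (cspan B \<inter> cball 0 r)"
  using assms
proof (induction B arbitrary: r)
  case empty
  have "({0} :: 'a set) \<inter> cball 0 r = (if r < 0 then {} else {0})" by auto
  then show ?case by simp
next
  case (insert e B)
  show ?case
  proof (cases "e \<in> cspan B")
    case True
    then show ?thesis using insert.IH complex_vector.span_redundant by metis
  next
    case False
    obtain d where d: "d > 0" "\<And>u a. u \<in> cspan B \<Longrightarrow> norm a * d \<le> norm (u + a *\<^sub>C e)"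
      using norm_line_coefficient_le[OF complex_vector.subspace_span closed_cspan_finite[OF insert(1)] False]
      by blast
    define K where "K = (\<lambda>(u, a). u + a *\<^sub>C e) ` ((cspan B \<inter> cball 0 (r + r / d * norm e)) \<times> cball 0 (r / d))"
    have "continuous_on S (\<lambda>(u, a). u + a *\<^sub>C e)" for S :: "('a \<times> complex) set"
      unfolding split_beta
      by (intro continuous_on_add continuous_on_scaleC continuous_on_fst continuous_on_snd
          continuous_on_const continuous_on_id)
    then have "compact K"
      unfolding K_def by (intro compact_continuous_image compact_Times insert.IH compact_cball)
    moreover have "cspan (insert e B) \<inter> cball 0 r = K \<inter> cball 0 r"
    proof
      show "K \<inter> cball 0 r \<subseteq> cspan (insert e B) \<inter> cball 0 r"
        unfolding K_def cspan_insert_eq by auto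
      show "cspan (insert e B) \<inter> cball 0 r \<subseteq> K \<inter> cball 0 r"
      proof
        fix x assume x: "x \<in> cspan (insert e B) \<inter> cball 0 r"
        then obtain u a where ua: "x = u + a *\<^sub>C e" "u \<in> cspan B"
          unfolding cspan_insert_eq by auto
        have "norm a * d \<le> r" using d(2)[OF ua(2), of a] x ua by simp
        then have a: "norm a \<le> r / d" using d(1) by (simp add: field_simps)
        have "norm u \<le> norm x + norm (a *\<^sub>C e)"
          using norm_triangle_ineq4[of x "a *\<^sub>C e"] ua(1) by simp
        also have "\<dots> \<le> r + r / d * norm e"
          using x mult_right_mono[OF a, of "norm e"] by (intro add_mono) (auto simp: norm_scaleC)
        finally show "x \<in> K \<inter> cball 0 r"
          using x ua a unfolding K_def by force
      qed
    qed
    ultimately show ?thesis by (simp add: compact_Int_closed)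
  qed
qed

text \<open>The common zero set of a set of functionals. For finite sets of bounded functionals these are the
  closed subspaces of finite codimension; they serve as such throughout.\<close>

definition joint_kernel :: "('a::complex_normed_vector \<Rightarrow> complex) set \<Rightarrow> 'a set"
  where "joint_kernel \<Phi> = {x. \<forall>\<phi>\<in>\<Phi>. \<phi> x = 0}"

lemma joint_kernel_empty [simp]: "joint_kernel {} = UNIV"
  by (simp add: joint_kernel_def)

lemma joint_kernel_insert: "joint_kernel (insert \<phi> \<Phi>) = joint_kernel \<Phi> \<inter> {x. \<phi> x = 0}"
  by (auto simp: joint_kernel_def)

lemma csubspace_joint_kernel:
  assumes "\<And>\<phi>. \<phi> \<in> \<Phi> \<Longrightarrow> bounded_clinear \<phi>"
  shows "csubspace (joint_kernel \<Phi>)"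
  unfolding joint_kernel_def
  by (rule csubspaceI)
    (auto simp: assms bounded_clinear_zero bounded_clinear_add bounded_clinear_scaleC scaleC_complex_def)

lemma closed_joint_kernel:
  assumes "\<And>\<phi>. \<phi> \<in> \<Phi> \<Longrightarrow> bounded_clinear \<phi>"
  shows "closed (joint_kernel \<Phi>)"
proof -
  have "joint_kernel \<Phi> = (\<Inter>\<phi>\<in>\<Phi>. {x. \<phi> x = 0})"
    by (auto simp: joint_kernel_def)
  moreover have "closed {x. \<phi> x = 0}" if "\<phi> \<in> \<Phi>" for \<phi>
    by (intro closed_Collect_eq bounded_clinear_continuous_on assms that continuous_on_const)
  ultimately show ?thesis by auto
qed

text \<open>A functional that does not vanish on \<open>V\<close> makes \<open>V\<close> the sum of its kernel in \<open>V\<close> and a line.\<close>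

lemma kernel_split:
  assumes "bounded_clinear \<phi>" "csubspace V" "\<not> V \<subseteq> {x. \<phi> x = 0}"
  obtains v where "v \<in> V" "\<phi> v = (1::complex)" "\<And>x. x \<in> V \<Longrightarrow> x - \<phi> x *\<^sub>C v \<in> V \<inter> {x. \<phi> x = 0}"
proof -
  obtain w where w: "w \<in> V" "\<phi> w \<noteq> 0" using assms(3) by auto
  define v where "v = inverse (\<phi> w) *\<^sub>C w"
  have v: "v \<in> V" "\<phi> v = 1"
    using w assms by (simp_all add: v_def complex_vector.subspace_scale bounded_clinear_scaleC scaleC_complex_def)
  moreover have "x - \<phi> x *\<^sub>C v \<in> V \<inter> {x. \<phi> x = 0}" if "x \<in> V" for x
    using that v assms by (simp add: complex_vector.subspace_diff complex_vector.subspace_scale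
        bounded_clinear_diff bounded_clinear_scaleC scaleC_complex_def)
  ultimately show ?thesis using that by blast
qed

lemma not_cfinite_dim_kernel:
  assumes "\<not> cfinite_dim V" "csubspace V" "bounded_clinear (\<phi> :: _ \<Rightarrow> complex)"
  shows "\<not> cfinite_dim (V \<inter> {x. \<phi> x = 0})"
proof
  assume fd: "cfinite_dim (V \<inter> {x. \<phi> x = 0})"
  have "\<not> V \<subseteq> {x. \<phi> x = 0}"
    using fd assms(1) by (auto simp: Int_absorb2)
  then obtain v where v: "v \<in> V" "\<phi> v = 1" "\<And>x. x \<in> V \<Longrightarrow> x - \<phi> x *\<^sub>C v \<in> V \<inter> {x. \<phi> x = 0}"
    using kernel_split[OF assms(3,2)] by blast
  obtain B where B: "finite B" "cspan B = V \<inter> {x. \<phi> x = 0}"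
    using fd by (auto simp: cfinite_dim_def)
  have "cspan (insert v B) = V"
  proof
    show "cspan (insert v B) \<subseteq> V"
      unfolding cspan_insert_eq B using v(1) assms(2)
      by (auto intro!: complex_vector.subspace_add complex_vector.subspace_scale)
    show "V \<subseteq> cspan (insert v B)"
      unfolding complex_vector.span_breakdown_eq subset_iff B using v(3) by blast
  qed
  then show False using assms(1) B(1) unfolding cfinite_dim_def by blast
qed

lemma not_cfinite_dim_joint_kernel:
  assumes "finite \<Phi>" "\<And>\<phi>. \<phi> \<in> \<Phi> \<Longrightarrow> bounded_clinear \<phi>" "\<not> cfinite_dim V" "csubspace V"
  shows "\<not> cfinite_dim (V \<inter> joint_kernel \<Phi>)"
  using assms
proof (induction \<Phi>)
  case (insert \<phi> \<Phi>)
  have "csubspace (V \<inter> joint_kernel \<Phi>)"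
    using insert.prems by (intro complex_vector.subspace_inter csubspace_joint_kernel) auto
  then have "\<not> cfinite_dim (V \<inter> joint_kernel \<Phi> \<inter> {x. \<phi> x = 0})"
    using insert by (intro not_cfinite_dim_kernel) auto
  then show ?case by (simp add: joint_kernel_insert Int_assoc)
qed simp

lemma not_cfinite_dim_nonzero:
  assumes "\<not> cfinite_dim V" "csubspace V"
  obtains x where "x \<in> V" "x \<noteq> 0"
proof -
  have "V \<noteq> {0}" using assms(1) by (metis cfinite_dim_def complex_vector.span_empty finite.emptyI)
  then show ?thesis using that complex_vector.subspace_0[OF assms(2)] by blast
qed

lemma dense_inter_joint_kernel:
  assumes "finite \<Phi>" "\<And>\<phi>. \<phi> \<in> \<Phi> \<Longrightarrow> bounded_clinear \<phi>" "csubspace D" "closure D = UNIV"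
  shows "joint_kernel \<Phi> \<subseteq> closure (D \<inter> joint_kernel \<Phi>)"
  using assms
proof (induction \<Phi>)
  case (insert \<phi> \<Phi>)
  let ?E = "D \<inter> joint_kernel \<Phi>"
  have \<phi>: "bounded_clinear \<phi>" using insert.prems by simp
  have sub: "joint_kernel \<Phi> \<subseteq> closure ?E" using insert by simp
  have csE: "csubspace ?E"
    using insert.prems by (intro complex_vector.subspace_inter csubspace_joint_kernel) auto
  show ?case
  proof
    fix x assume x: "x \<in> joint_kernel (insert \<phi> \<Phi>)"
    show "x \<in> closure (D \<inter> joint_kernel (insert \<phi> \<Phi>))"
    proof (cases "?E \<subseteq> {x. \<phi> x = 0}")
      case True
      then have "D \<inter> joint_kernel (insert \<phi> \<Phi>) = ?E" by (auto simp: joint_kernel_insert)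
      then show ?thesis using x sub by (auto simp: joint_kernel_insert)
    next
      case False
      obtain v where v: "v \<in> ?E" "\<phi> v = 1" "\<And>y. y \<in> ?E \<Longrightarrow> y - \<phi> y *\<^sub>C v \<in> ?E \<inter> {x. \<phi> x = 0}"
        using kernel_split[OF \<phi> csE False] by blast
      obtain f where f: "\<And>n. f n \<in> ?E" "f \<longlonglongrightarrow> x"
        using x sub closure_sequential[of x ?E] unfolding joint_kernel_insert by blast
      have "(\<lambda>n. f n - \<phi> (f n) *\<^sub>C v) \<longlonglongrightarrow> x - \<phi> x *\<^sub>C v"
        by (intro tendsto_diff f tendsto_scaleC bounded_clinear_tendsto[OF \<phi>] tendsto_const)
      then have "(\<lambda>n. f n - \<phi> (f n) *\<^sub>C v) \<longlonglongrightarrow> x"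
        using x by (simp add: joint_kernel_insert)
      moreover have "f n - \<phi> (f n) *\<^sub>C v \<in> D \<inter> joint_kernel (insert \<phi> \<Phi>)" for n
        using v(3)[OF f(1)] by (simp add: joint_kernel_insert)
      ultimately show ?thesis
        unfolding closure_sequential by (intro exI[of _ "\<lambda>n. f n - \<phi> (f n) *\<^sub>C v"]) blast
    qed
  qed
qed simp

text \<open>Finitely many functionals norm a finite-dimensional space up to a constant, so that space is
  complemented with constant 4 by their joint kernel. This is the step that makes Mazur's
  construction of basic sequences work.\<close>

lemma finite_dim_norming:
  fixes B :: "'a::complex_banach set"
  assumes "finite B"
  obtains \<Phi> :: "('a \<Rightarrow> complex) set" where "finite \<Phi>" "\<And>\<phi>. \<phi> \<in> \<Phi> \<Longrightarrow> bounded_clinear \<phi>"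
    "\<And>v w. v \<in> cspan B \<Longrightarrow> w \<in> joint_kernel \<Phi> \<Longrightarrow> norm v \<le> 4 * norm (v + w)"
proof -
  have "\<forall>x::'a. \<exists>\<phi>. bounded_clinear \<phi> \<and> (\<forall>y. norm (\<phi> y) \<le> 2 * norm y) \<and> Re (\<phi> x) = norm x"
    by (metis norming_functional)
  then obtain F :: "'a \<Rightarrow> 'a \<Rightarrow> complex" where F: "\<And>x. bounded_clinear (F x)"
    "\<And>x y. norm (F x y) \<le> 2 * norm y" "\<And>x. Re (F x x) = norm x" by metis
  define S where "S = cspan B \<inter> cball 0 1 \<inter> {x. norm x = 1}"
  have "compact S" unfolding S_def using compact_cspan_finite[OF assms] by (rule compact_Int_closed)
    (intro closed_Collect_eq continuous_on_norm continuous_on_id continuous_on_const)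
  moreover have "open {y. norm (F x y) > 1/2}" for x
    by (intro open_Collect_less continuous_on_norm bounded_clinear_continuous_on F continuous_on_const)
  moreover have "S \<subseteq> (\<Union>x\<in>S. {y. norm (F x y) > 1/2})"
  proof
    fix x assume "x \<in> S"
    then have "norm (F x x) \<ge> 1" using F(3)[of x] complex_Re_le_cmod[of "F x x"] by (simp add: S_def)
    then have "norm (F x x) > 1/2" by linarith
    then show "x \<in> (\<Union>x\<in>S. {y. norm (F x y) > 1/2})" using \<open>x \<in> S\<close> by blast
  qed
  ultimately obtain S' where S': "S' \<subseteq> S" "finite S'" "S \<subseteq> (\<Union>x\<in>S'. {y. norm (F x y) > 1/2})"
    by (rule compactE_image[of S S]) auto
  have "norm v \<le> 4 * norm (v + w)" if v: "v \<in> cspan B" and w: "w \<in> joint_kernel (F ` S')" for v w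
  proof (cases "v = 0")
    case False
    define c where "c = complex_of_real (inverse (norm v))"
    have "c *\<^sub>C v \<in> S"
      using v False by (simp add: S_def c_def complex_vector.span_scale norm_scaleC norm_inverse)
    then obtain x where x: "x \<in> S'" "norm (F x (c *\<^sub>C v)) > 1/2" using subsetD[OF S'(3)] by fastforce
    have "norm (F x (c *\<^sub>C v)) = inverse (norm v) * norm (F x v)"
      unfolding bounded_clinear_scaleC[OF F(1)] norm_scaleC c_def norm_of_real by simp
    also have "F x v = F x (v + w)"
      using w x(1) by (simp add: joint_kernel_def bounded_clinear_add[OF F(1)])
    finally have "1/2 < inverse (norm v) * norm (F x (v + w))" using x(2) by simp
    then have "norm v < 2 * norm (F x (v + w))" using False by (simp add: field_simps)
    then show ?thesis using F(2)[of x "v + w"] by linarith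
  qed simp
  then show ?thesis using that[of "F ` S'"] S'(2) F(1) by blast
qed

section \<open>Open mapping and left Fredholm operators\<close>

text \<open>The Baire category half of the open mapping theorem: elements of a closed range have approximate
  preimages of controlled norm.\<close>

lemma closed_range_approx_preimage:
  fixes S :: "'a::complex_banach \<Rightarrow> 'a"
  assumes S: "bounded_clinear S" and cl: "closed (range S)"
  obtains C where "C > 0" "\<And>y. y \<in> range S \<Longrightarrow> \<exists>x. norm x \<le> C * norm y \<and> norm (y - S x) \<le> norm y / 2"
proof -
  have lin: "linear S" using S by (rule bounded_clinear_linear)
  define X where "X = top_of_set (range S)"
  define A where "A n = range S \<inter> closure (S ` cball 0 (real n))" for n
  \<comment> \<open>Otherwise the complete space \<open>range S\<close> would be meagre in itself.\<close>
  have "\<exists>n. X interior_of A n \<noteq> {}"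
  proof (rule ccontr)
    assume "\<nexists>n. X interior_of A n \<noteq> {}"
    then have "X interior_of \<Union>(range A) = {}"
      unfolding X_def
      by (intro Baire_category_alt disjI1 completely_metrizable_space_closedin[OF completely_metrizable_space_euclidean])
        (auto simp: cl A_def closedin_closed_Int Int_commute simp flip: closed_closedin)
    moreover have "range S \<subseteq> \<Union>(range A)"
    proof
      fix y assume "y \<in> range S"
      then obtain x where "y = S x" by auto
      moreover obtain n where "norm x \<le> real n" using real_arch_simple by blast
      ultimately have "y \<in> A n" using closure_subset by (force simp: A_def)
      then show "y \<in> \<Union>(range A)" by blast
    qed
    then have "\<Union>(range A) = range S" by (auto simp: A_def)
    ultimately show False by (simp add: X_def interior_of_topspace[of "top_of_set (range S)", simplified])
  qed
  then obtain n y0 where "y0 \<in> X interior_of A n" by blast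
  then obtain U where U: "openin X U" "y0 \<in> U" "U \<subseteq> A n" unfolding interior_of_def by auto
  then obtain e where e: "e > 0" "\<And>y. y \<in> range S \<Longrightarrow> dist y y0 < e \<Longrightarrow> y \<in> A n"
    and y0: "y0 \<in> range S"
    unfolding X_def openin_euclidean_subtopology_iff by blast
  define C where "C = 4 * (real n + 1) / e"
  have "\<exists>x. norm x \<le> C * norm y \<and> norm (y - S x) \<le> norm y / 2" if y: "y \<in> range S" for y
  proof (cases "y = 0")
    case True
    then show ?thesis by (intro exI[of _ 0]) (simp add: linear_0[OF lin])
  next
    case False
    define r where "r = e / (2 * norm y)"
    have r: "r > 0" using e(1) False by (simp add: r_def)
    have sub: "subspace (range S)" by (rule linear_subspace_image[OF lin subspace_UNIV])
    have "y0 + r *\<^sub>R y \<in> range S" using sub y y0 by (simp add: subspace_add subspace_scale)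
    moreover have "dist (y0 + r *\<^sub>R y) y0 < e"
      using e(1) False by (simp add: dist_norm r_def)
    ultimately have "y0 + r *\<^sub>R y \<in> closure (S ` cball 0 (real n))" using e(2) by (simp add: A_def)
    then obtain x1 where x1: "norm x1 \<le> n" "dist (S x1) (y0 + r *\<^sub>R y) < e / 8"
      using e(1) unfolding closure_approachable by (force dest: spec[of _ "e / 8"])
    have "y0 \<in> closure (S ` cball 0 (real n))" using e y0 by (simp add: A_def)
    then obtain x2 where x2: "norm x2 \<le> n" "dist (S x2) y0 < e / 8"
      using e(1) unfolding closure_approachable by (force dest: spec[of _ "e / 8"])
    \<comment> \<open>The interior point \<open>y0\<close> is subtracted off, which moves the ball to the origin.\<close>
    define x where "x = inverse r *\<^sub>R (x1 - x2)"
    have "norm x \<le> inverse r * (2 * real n)"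
      using norm_triangle_ineq4[of x1 x2] x1 x2 r by (simp add: x_def)
    also have "\<dots> \<le> C * norm y"
      using e(1) False by (simp add: C_def r_def field_simps)
    finally have "norm x \<le> C * norm y" .
    moreover have "norm (y - S x) \<le> norm y / 2"
    proof -
      have "r *\<^sub>R (y - S x) = (y0 + r *\<^sub>R y - S x1) - (y0 - S x2)"
        using r by (simp add: x_def linear_diff[OF lin] linear_scale[OF lin] scaleR_diff_right)
      then have "norm (r *\<^sub>R (y - S x)) \<le> norm (y0 + r *\<^sub>R y - S x1) + norm (y0 - S x2)"
        using norm_triangle_ineq4 by metis
      also have "\<dots> \<le> e / 4"
        using x1(2) x2(2) by (simp add: dist_norm norm_minus_commute)
      also have "\<dots> = r * (norm y / 2)" using False by (simp add: r_def)
      finally show ?thesis using r by simp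
    qed
    ultimately show ?thesis by blast
  qed
  moreover have "C > 0" using e(1) by (simp add: C_def)
  ultimately show ?thesis using that by blast
qed

lemma closed_range_bounded_preimage:
  fixes S :: "'a::complex_banach \<Rightarrow> 'a"
  assumes S: "bounded_clinear S" and cl: "closed (range S)"
  obtains C where "C > 0" "\<And>y. y \<in> range S \<Longrightarrow> \<exists>x. S x = y \<and> norm x \<le> C * norm y"
proof -
  have lin: "linear S" using S by (rule bounded_clinear_linear)
  obtain C where C: "C > 0"
    "\<And>y. y \<in> range S \<Longrightarrow> \<exists>x. norm x \<le> C * norm y \<and> norm (y - S x) \<le> norm y / 2"
    using closed_range_approx_preimage[OF S cl] by blast
  then obtain g where g: "\<And>y. y \<in> range S \<Longrightarrow> norm (g y) \<le> C * norm y"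
    "\<And>y. y \<in> range S \<Longrightarrow> norm (y - S (g y)) \<le> norm y / 2" by metis
  have "\<exists>x. S x = y \<and> norm x \<le> (2 * C) * norm y" if y: "y \<in> range S" for y
  proof -
    \<comment> \<open>\<open>r n\<close> is the remainder after \<open>n\<close> corrections; each correction halves it.\<close>
    define r where "r n = ((\<lambda>z. z - S (g z)) ^^ n) y" for n
    have r0: "r 0 = y" and rS: "r (Suc n) = r n - S (g (r n))" for n by (simp_all add: r_def)
    have r: "r n \<in> range S \<and> norm (r n) \<le> norm y * (1/2) ^ n" for n
    proof (induction n)
      case (Suc n)
      have "r (Suc n) \<in> range S"
        unfolding rS using Suc by (intro subspace_diff linear_subspace_image[OF lin] subspace_UNIV) auto
      moreover have "norm (r (Suc n)) \<le> norm y * (1/2) ^ Suc n"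
        using g(2)[of "r n"] Suc unfolding rS by auto
      ultimately show ?case by simp
    qed (simp add: r0 y)
    have gle: "norm (g (r n)) \<le> C * norm y * (1/2) ^ n" for n
    proof -
      have "norm (g (r n)) \<le> C * norm (r n)" using g(1) r by blast
      also have "\<dots> \<le> C * (norm y * (1/2) ^ n)" using r C(1) by (intro mult_left_mono) auto
      finally show ?thesis by (simp add: mult.assoc)
    qed
    have sumb: "summable (\<lambda>n. C * norm y * (1/2) ^ n)"
      by (intro summable_mult summable_geometric) simp
    have sg: "summable (\<lambda>n. norm (g (r n)))"
      by (rule summable_comparison_test[OF _ sumb]) (use gle in auto)
    define x where "x = (\<Sum>n. g (r n))"
    have "norm x \<le> (\<Sum>n. norm (g (r n)))" unfolding x_def by (rule summable_norm[OF sg])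
    also have "\<dots> \<le> (\<Sum>n. C * norm y * (1/2) ^ n)" by (rule suminf_le[OF gle sg sumb])
    also have "\<dots> = 2 * C * norm y"
      by (subst suminf_mult) (simp_all add: suminf_geometric)
    finally have "norm x \<le> 2 * C * norm y" .
    moreover have "S x = y"
    proof -
      have "(\<lambda>N. \<Sum>n<N. g (r n)) \<longlonglongrightarrow> x"
        unfolding x_def by (rule summable_LIMSEQ[OF summable_norm_cancel[OF sg]])
      then have 1: "(\<lambda>N. S (\<Sum>n<N. g (r n))) \<longlonglongrightarrow> S x" by (rule bounded_clinear_tendsto[OF S])
      have "S (\<Sum>n<N. g (r n)) = y - r N" for N
        by (induction N) (simp_all add: linear_0[OF lin] linear_add[OF lin] r0 rS)
      moreover have "r \<longlonglongrightarrow> 0"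
      proof (rule Lim_null_comparison)
        show "\<forall>\<^sub>F n in sequentially. norm (r n) \<le> norm y * (1/2) ^ n" using r by simp
        show "(\<lambda>n. norm y * (1/2) ^ n) \<longlonglongrightarrow> 0"
          by (intro tendsto_mult_right_zero LIMSEQ_power_zero) simp
      qed
      then have "(\<lambda>N. y - r N) \<longlonglongrightarrow> y - 0" by (intro tendsto_diff tendsto_const)
      ultimately show ?thesis using 1 LIMSEQ_unique by fastforce
    qed
    ultimately show ?thesis by blast
  qed
  then show ?thesis using that[of "2 * C"] C(1) by simp
qed

text \<open>The functionals are chosen to norm the kernel of \<open>S\<close>: a vector \<open>x\<close> in their joint kernel is
  controlled by any \<open>z\<close> with \<open>S z = S x\<close>, because \<open>z - x\<close> lies in the kernel of \<open>S\<close>.\<close>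

lemma left_Fredholm_bounded_below:
  fixes S :: "'a::complex_banach \<Rightarrow> 'a"
  assumes S: "bounded_clinear S" and "left_Fredholm S"
  obtains \<Phi> :: "('a \<Rightarrow> complex) set" and c where "finite \<Phi>" "\<And>\<phi>. \<phi> \<in> \<Phi> \<Longrightarrow> bounded_clinear \<phi>"
    "c > 0" "\<And>x. x \<in> joint_kernel \<Phi> \<Longrightarrow> c * norm x \<le> norm (S x)"
proof -
  have cl: "closed (range S)" and fd: "cfinite_dim {x. S x = 0}"
    using assms(2) by (auto simp: left_Fredholm_def)
  obtain B where B: "finite B" "cspan B = {x. S x = 0}" using fd by (auto simp: cfinite_dim_def)
  obtain \<Phi> :: "('a \<Rightarrow> complex) set" where \<Phi>: "finite \<Phi>" "\<And>\<phi>. \<phi> \<in> \<Phi> \<Longrightarrow> bounded_clinear \<phi>"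
    "\<And>v w. v \<in> cspan B \<Longrightarrow> w \<in> joint_kernel \<Phi> \<Longrightarrow> norm v \<le> 4 * norm (v + w)"
    using finite_dim_norming[OF B(1)] by blast
  obtain C where C: "C > 0" "\<And>y. y \<in> range S \<Longrightarrow> \<exists>x. S x = y \<and> norm x \<le> C * norm y"
    using closed_range_bounded_preimage[OF S cl] by blast
  have "inverse (5 * C) * norm x \<le> norm (S x)" if x: "x \<in> joint_kernel \<Phi>" for x
  proof -
    obtain z where z: "S z = S x" "norm z \<le> C * norm (S x)" using C(2) by blast
    have "z - x \<in> cspan B" using z by (simp add: B bounded_clinear_diff[OF S])
    from \<Phi>(3)[OF this x] have "norm (z - x) \<le> 4 * norm z" by simp
    then have "norm x \<le> 5 * norm z" using norm_triangle_ineq3[of x z] by (simp add: norm_minus_commute)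
    then have "norm x \<le> 5 * (C * norm (S x))" using z(2) by linarith
    then show ?thesis using C(1) by (simp add: field_simps)
  qed
  then show ?thesis using that[of \<Phi> "inverse (5 * C)"] \<Phi> C(1) by simp
qed

text \<open>Failure of the left Fredholm property is inherited by subspaces of finite codimension: passing to
  the kernel of one functional changes the image by at most a line, and closedness survives adding a
  line.\<close>

lemma not_left_Fredholm_joint_kernel:
  fixes S :: "'a::complex_banach \<Rightarrow> 'a"
  assumes S: "bounded_clinear S" and nF: "\<not> left_Fredholm S"
    and "finite \<Phi>" "\<And>\<phi>. \<phi> \<in> \<Phi> \<Longrightarrow> bounded_clinear \<phi>"
  shows "\<not> closed (S ` joint_kernel \<Phi>) \<or> \<not> cfinite_dim ({x. S x = 0} \<inter> joint_kernel \<Phi>)"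
  using assms(3,4)
proof (induction \<Phi>)
  case empty
  then show ?case using nF by (simp add: left_Fredholm_def)
next
  case (insert \<phi> \<Phi>)
  let ?L = "joint_kernel \<Phi>" and ?L' = "joint_kernel (insert \<phi> \<Phi>)" and ?N = "{x. S x = 0}"
  have \<phi>: "bounded_clinear \<phi>" using insert.prems by simp
  have L: "csubspace ?L" and L': "csubspace ?L'"
    using insert.prems by (auto intro: csubspace_joint_kernel)
  have N: "csubspace ?N"
    by (rule csubspaceI)
      (simp_all add: bounded_clinear_zero[OF S] bounded_clinear_add[OF S] bounded_clinear_scaleC[OF S])
  have IH: "\<not> closed (S ` ?L) \<or> \<not> cfinite_dim (?N \<inter> ?L)" using insert by simp
  show ?case
  proof (cases "?L \<subseteq> {x. \<phi> x = 0}")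
    case True
    then have "?L' = ?L" by (auto simp: joint_kernel_insert)
    then show ?thesis using IH by simp
  next
    case False
    obtain v where v: "v \<in> ?L" "\<phi> v = 1" "\<And>x. x \<in> ?L \<Longrightarrow> x - \<phi> x *\<^sub>C v \<in> ?L'"
      using kernel_split[OF \<phi> L False] unfolding joint_kernel_insert by blast
    have "closed (S ` ?L)" if "closed (S ` ?L')"
    proof -
      have "csubspace (S ` ?L')"
      proof (rule csubspaceI)
        show "0 \<in> S ` ?L'"
          using complex_vector.subspace_0[OF L'] bounded_clinear_zero[OF S] by (metis image_eqI)
        show "x + y \<in> S ` ?L'" if "x \<in> S ` ?L'" "y \<in> S ` ?L'" for x y
          using that complex_vector.subspace_add[OF L'] bounded_clinear_add[OF S] by (smt (verit) image_iff)
        show "c *\<^sub>C x \<in> S ` ?L'" if "x \<in> S ` ?L'" for c x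
          using that complex_vector.subspace_scale[OF L'] bounded_clinear_scaleC[OF S] by (smt (verit) image_iff)
      qed
      then have "closed {u + a *\<^sub>C S v | u a. u \<in> S ` ?L'}"
        using that by (rule closed_csubspace_plus_line)
      also have "{u + a *\<^sub>C S v | u a. u \<in> S ` ?L'} = S ` ?L"
      proof
        show "{u + a *\<^sub>C S v | u a. u \<in> S ` ?L'} \<subseteq> S ` ?L"
        proof
          fix y assume "y \<in> {u + a *\<^sub>C S v | u a. u \<in> S ` ?L'}"
          then obtain x a where xa: "x \<in> ?L'" "y = S x + a *\<^sub>C S v" by auto
          then have "y = S (x + a *\<^sub>C v)"
            by (simp add: bounded_clinear_add[OF S] bounded_clinear_scaleC[OF S])
          moreover have "x + a *\<^sub>C v \<in> ?L"
            using xa v(1) L by (intro complex_vector.subspace_add complex_vector.subspace_scale)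
              (auto simp: joint_kernel_insert)
          ultimately show "y \<in> S ` ?L" by blast
        qed
        show "S ` ?L \<subseteq> {u + a *\<^sub>C S v | u a. u \<in> S ` ?L'}"
        proof
          fix y assume "y \<in> S ` ?L"
          then obtain x where x: "x \<in> ?L" "y = S x" by auto
          have "y = S (x - \<phi> x *\<^sub>C v) + \<phi> x *\<^sub>C S v"
            by (simp add: x bounded_clinear_diff[OF S] bounded_clinear_scaleC[OF S])
          then show "y \<in> {u + a *\<^sub>C S v | u a. u \<in> S ` ?L'}" using v(3)[OF x(1)] by blast
        qed
      qed
      finally show ?thesis .
    qed
    moreover have "\<not> cfinite_dim (?N \<inter> ?L')" if "\<not> cfinite_dim (?N \<inter> ?L)"
      using not_cfinite_dim_kernel[OF that complex_vector.subspace_inter[OF N L] \<phi>]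
      by (simp add: joint_kernel_insert Int_assoc)
    ultimately show ?thesis using IH by blast
  qed
qed

lemma not_left_Fredholm_small_vector:
  fixes S :: "'a::complex_banach \<Rightarrow> 'a"
  assumes S: "bounded_clinear S" and nF: "\<not> left_Fredholm S"
    and \<Phi>: "finite \<Phi>" "\<And>\<phi>. \<phi> \<in> \<Phi> \<Longrightarrow> bounded_clinear \<phi>"
    and D: "csubspace D" "closure D = UNIV" and "c > 0"
  obtains x where "x \<in> D \<inter> joint_kernel \<Phi>" "norm x = 1" "norm (S x) < c"
proof -
  let ?L = "joint_kernel \<Phi>"
  have "\<exists>x\<in>D \<inter> ?L. norm (S x) < c * norm x"
  proof (rule ccontr)
    assume "\<not> ?thesis"
    then have DL: "D \<inter> ?L \<subseteq> {x. c * norm x \<le> norm (S x)}" by (auto simp: not_less)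
    have "closed {x. c * norm x \<le> norm (S x)}"
      by (intro closed_Collect_le continuous_intros bounded_clinear_continuous_on[OF S])
    then have below: "c * norm x \<le> norm (S x)" if "x \<in> ?L" for x
      using dense_inter_joint_kernel[OF \<Phi> D] closure_minimal[OF DL] that by blast
    have clL: "closed ?L" by (rule closed_joint_kernel[OF \<Phi>(2)])
    have csL: "csubspace ?L" by (rule csubspace_joint_kernel[OF \<Phi>(2)])
    have "x = 0" if "x \<in> {x. S x = 0} \<inter> ?L" for x
      using below[of x] that \<open>c > 0\<close> by (simp add: mult_le_0_iff)
    then have "{x. S x = 0} \<inter> ?L = {0}"
      using bounded_clinear_zero[OF S] complex_vector.subspace_0[OF csL] by auto
    then have fd: "cfinite_dim ({x. S x = 0} \<inter> ?L)"
      unfolding cfinite_dim_def by (metis complex_vector.span_empty finite.emptyI)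
    have "closed (S ` ?L)"
      unfolding closed_sequential_limits
    proof (intro allI impI, elim conjE)
      fix f l assume f: "\<forall>n. f n \<in> S ` ?L" and lim: "f \<longlonglongrightarrow> l"
      have "\<forall>n. \<exists>x. x \<in> ?L \<and> f n = S x" using f by auto
      then obtain x where x: "\<And>n. x n \<in> ?L" "\<And>n. f n = S (x n)" by metis
      have "Cauchy f" using lim by (rule LIMSEQ_imp_Cauchy)
      have *: "c * dist (x m) (x n) \<le> dist (f m) (f n)" for m n
        using below[of "x m - x n"] complex_vector.subspace_diff[OF csL x(1) x(1), of m n]
        by (simp add: x(2) dist_norm bounded_clinear_diff[OF S])
      have "Cauchy x"
      proof (rule metric_CauchyI)
        fix r :: real assume "r > 0"
        then obtain N where N: "\<And>m n. m \<ge> N \<Longrightarrow> n \<ge> N \<Longrightarrow> dist (f m) (f n) < c * r"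
          using metric_CauchyD[OF \<open>Cauchy f\<close>, of "c * r"] \<open>c > 0\<close> by auto
        have "dist (x m) (x n) < r" if "m \<ge> N" "n \<ge> N" for m n
          using *[of m n] N[OF that] \<open>c > 0\<close> by (meson le_less_trans mult_less_cancel_left_pos)
        then show "\<exists>M. \<forall>m\<ge>M. \<forall>n\<ge>M. dist (x m) (x n) < r" by blast
      qed
      then obtain z where z: "x \<longlonglongrightarrow> z" using Cauchy_convergent_iff convergent_def by blast
      have "z \<in> ?L" using clL x(1) z unfolding closed_sequential_limits by blast
      moreover have "(\<lambda>n. S (x n)) \<longlonglongrightarrow> S z" by (rule bounded_clinear_tendsto[OF S z])
      then have "S z = l" using lim LIMSEQ_unique[of f] by (simp flip: x(2))
      ultimately show "l \<in> S ` ?L" by blast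
    qed
    then show False using not_left_Fredholm_joint_kernel[OF S nF \<Phi>] fd by blast
  qed
  then obtain x where x: "x \<in> D \<inter> ?L" "norm (S x) < c * norm x" by blast
  have "x \<noteq> 0" using x(2) by (auto simp: bounded_clinear_zero[OF S])
  define y where "y = complex_of_real (inverse (norm x)) *\<^sub>C x"
  have "y \<in> D \<inter> ?L"
    unfolding y_def by (intro complex_vector.subspace_scale complex_vector.subspace_inter D
        csubspace_joint_kernel \<Phi>(2) x(1))
  moreover have "norm y = 1" using \<open>x \<noteq> 0\<close> by (simp add: y_def norm_scaleC norm_inverse)
  moreover have "norm (S y) < c"
  proof -
    have "norm (S y) = inverse (norm x) * norm (S x)"
      unfolding y_def bounded_clinear_scaleC[OF S] norm_scaleC norm_of_real by simp
    also have "\<dots> < inverse (norm x) * (c * norm x)"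
      using x(2) \<open>x \<noteq> 0\<close> by (intro mult_strict_left_mono) auto
    also have "\<dots> = c" using \<open>x \<noteq> 0\<close> by simp
    finally show ?thesis .
  qed
  ultimately show ?thesis using that by blast
qed

section \<open>Exponential growth on finite-codimensional subspaces\<close>

lemma sum_roots_of_unity:
  fixes m i k :: nat
  assumes "i < m" "k < m"
  defines "\<omega> \<equiv> cis (2 * pi / real m)"
  shows "(\<Sum>j<m. inverse (\<omega> ^ j) ^ k * (\<omega> ^ j) ^ i) = (if i = k then of_nat m else 0)"
proof -
  have \<omega>0: "\<omega> \<noteq> 0" by (simp add: \<omega>_def)
  define z where "z = \<omega> ^ i * inverse \<omega> ^ k"
  have eq: "inverse (\<omega> ^ j) ^ k * (\<omega> ^ j) ^ i = z ^ j" for j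
    by (simp add: z_def power_mult_distrib power_inverse mult.commute flip: power_mult)
  show ?thesis
  proof (cases "i = k")
    case True
    then have "z = 1" using \<omega>0 by (simp add: z_def power_inverse)
    then show ?thesis using True unfolding eq by simp
  next
    case False
    have pw: "\<omega> ^ n = cis (2 * pi * real n / real m)" for n
      unfolding \<omega>_def Complex.DeMoivre by (rule arg_cong[of _ _ cis]) simp
    have "inj_on (\<lambda>n. cis (2 * pi * real n / real m)) {..<m}"
      using assms(1) by (intro bij_betw_imp_inj_on[OF Complex.bij_betw_roots_unity]) simp
    from inj_onD[OF this, of i k] have "\<omega> ^ i \<noteq> \<omega> ^ k"
      using False assms(1,2) unfolding pw by blast
    then have "z \<noteq> 1" using \<omega>0 by (simp add: z_def power_inverse field_simps)
    moreover have "\<omega> ^ m = 1" unfolding pw using assms(1) by simp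
    then have "z ^ m = 1"
      by (simp add: z_def power_mult_distrib power_inverse flip: power_mult)
        (metis mult.commute power_mult power_one inverse_1 mult_1)
    ultimately show ?thesis using False geometric_sum[of z m] by (simp add: eq)
  qed
qed

text \<open>Cauchy's estimate for a polynomial with vector coefficients, whose monomials may have repeated
  exponents \<open>e i\<close>, by averaging over the \<open>m\<close>-th roots of unity.\<close>

lemma norm_coefficient_le:
  fixes v :: "'i \<Rightarrow> 'a::complex_normed_vector"
  assumes "finite I" "\<And>i. i \<in> I \<Longrightarrow> e i < m" "k < m" "\<rho> \<ge> 0"
    and le: "\<And>z. norm z = \<rho> \<Longrightarrow> norm (\<Sum>i\<in>I. z ^ e i *\<^sub>C v i) \<le> B"
  shows "\<rho> ^ k * norm (\<Sum>i | i \<in> I \<and> e i = k. v i) \<le> B"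
proof -
  define \<omega> where "\<omega> = cis (2 * pi / real m)"
  define z where "z j = complex_of_real \<rho> * \<omega> ^ j" for j
  have nz: "norm (z j) = \<rho>" for j using assms(4) by (simp add: z_def norm_mult norm_power \<omega>_def)
  have m: "m > 0" using assms(3) by simp
  have "(\<Sum>j<m. inverse (\<omega> ^ j) ^ k *\<^sub>C (\<Sum>i\<in>I. z j ^ e i *\<^sub>C v i))
      = (\<Sum>i\<in>I. \<Sum>j<m. (complex_of_real \<rho> ^ e i * (inverse (\<omega> ^ j) ^ k * (\<omega> ^ j) ^ e i)) *\<^sub>C v i)"
    unfolding complex_vector.scale_sum_right
    by (subst sum.swap) (simp add: scaleC_scaleC z_def power_mult_distrib mult_ac)
  also have "\<dots> = (\<Sum>i\<in>I. (complex_of_real \<rho> ^ e i * (\<Sum>j<m. inverse (\<omega> ^ j) ^ k * (\<omega> ^ j) ^ e i)) *\<^sub>C v i)"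
    by (simp only: complex_vector.scale_sum_left sum_distrib_left)
  also have "\<dots> = (\<Sum>i\<in>I. if e i = k then (complex_of_real \<rho> ^ k * of_nat m) *\<^sub>C v i else 0)"
    using assms(2,3) unfolding \<omega>_def by (intro sum.cong refl) (simp add: sum_roots_of_unity)
  also have "\<dots> = (complex_of_real \<rho> ^ k * of_nat m) *\<^sub>C (\<Sum>i | i \<in> I \<and> e i = k. v i)"
    unfolding complex_vector.scale_sum_right using assms(1)
    by (simp add: sum.inter_filter)
  finally have "real m * (\<rho> ^ k * norm (\<Sum>i | i \<in> I \<and> e i = k. v i))
      = norm (\<Sum>j<m. inverse (\<omega> ^ j) ^ k *\<^sub>C (\<Sum>i\<in>I. z j ^ e i *\<^sub>C v i))"
    using assms(4) by (simp add: norm_scaleC norm_mult norm_power)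
  also have "\<dots> \<le> (\<Sum>j<m. B)"
    using le[OF nz] by (intro sum_norm_le) (simp add: norm_scaleC norm_power norm_inverse \<omega>_def)
  finally show ?thesis using m by simp
qed

text \<open>The polynomial \<open>(T ^^ L - z ^ L) / (T - z)\<close> in \<open>T\<close> and \<open>z\<close>, applied to \<open>x\<close>.\<close>

definition truncated_resolvent ::
    "('a::complex_normed_vector \<Rightarrow> 'a) \<Rightarrow> nat \<Rightarrow> complex \<Rightarrow> 'a \<Rightarrow> 'a"
  where "truncated_resolvent T L z x = (\<Sum>a<L. z ^ a *\<^sub>C (T ^^ (L - 1 - a)) x)"

lemma truncated_resolvent_Suc:
  assumes T: "bounded_clinear T"
  shows "truncated_resolvent T (Suc L) z x = T (truncated_resolvent T L z x) + z ^ L *\<^sub>C x"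
proof -
  have "T (z ^ a *\<^sub>C (T ^^ (L - 1 - a)) x) = z ^ a *\<^sub>C (T ^^ (L - a)) x" if "a < L" for a
  proof -
    have "L - a = Suc (L - 1 - a)" using that by simp
    then show ?thesis by (simp add: bounded_clinear_scaleC[OF T])
  qed
  then show ?thesis
    by (simp add: truncated_resolvent_def bounded_clinear_sum[OF T])
qed

lemma truncated_resolvent_telescope:
  assumes T: "bounded_clinear T"
  shows "T (truncated_resolvent T L z x) - z *\<^sub>C truncated_resolvent T L z x = (T ^^ L) x - z ^ L *\<^sub>C x"
proof (induction L)
  case 0
  show ?case by (simp add: truncated_resolvent_def bounded_clinear_zero[OF T] scaleC_of_real[of 1, simplified])
next
  case (Suc L)
  let ?q = "truncated_resolvent T L z x"
  have "T (truncated_resolvent T (Suc L) z x) - z *\<^sub>C truncated_resolvent T (Suc L) z x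
      = T (T ?q - z *\<^sub>C ?q) + (z ^ L *\<^sub>C T x - z ^ Suc L *\<^sub>C x)"
    by (simp add: truncated_resolvent_Suc[OF T] bounded_clinear_add[OF T] bounded_clinear_diff[OF T]
        bounded_clinear_scaleC[OF T] scaleC_add_right scaleC_scaleC algebra_simps)
  also have "\<dots> = (T ^^ Suc L) x - z ^ Suc L *\<^sub>C x"
    by (simp add: Suc bounded_clinear_diff[OF T] bounded_clinear_scaleC[OF T])
  finally show ?case .
qed

text \<open>The double sum is the square of the truncated resolvent applied to \<open>x\<close>. The lower bound for \<open>T - z\<close>
  is used twice, and telescoping turns the result into \<open>(T ^^ L - z ^ L)\<^sup>2 x\<close>. Only powers
  \<open>(T ^^ i) x\<close> with \<open>i < 2 * L\<close> enter the vectors to which the lower bound is applied.\<close>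

lemma truncated_resolvent_square_bound:
  assumes T: "bounded_clinear T" and V: "csubspace V"
    and below: "\<And>y. y \<in> V \<Longrightarrow> c * norm y \<le> norm (T y - z *\<^sub>C y)" and "c > 0"
    and x: "\<And>i. i < 2 * L \<Longrightarrow> (T ^^ i) x \<in> V"
  shows "c\<^sup>2 * norm (\<Sum>(a, b)\<in>{..<L} \<times> {..<L}. z ^ (a + b) *\<^sub>C (T ^^ (2 * L - 2 - (a + b))) x)
    \<le> norm ((T ^^ (2 * L)) x) + 2 * norm z ^ L * norm ((T ^^ L) x) + norm z ^ (2 * L) * norm x"
proof -
  let ?q = "truncated_resolvent T L z"
  have Tn: "bounded_clinear (T ^^ n)" for n by (rule bounded_clinear_funpow[OF T])
  have fp: "(T ^^ i) ((T ^^ j) y) = (T ^^ (i + j)) y" for i j y by (simp add: funpow_add)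
  have comm: "T ((T ^^ n) y) = (T ^^ n) (T y)" for n y by (simp add: funpow_swap1)
  define u where "u = ?q x"
  define s where "s = ?q u"
  define w where "w = (T ^^ L) u - z ^ L *\<^sub>C u"
  have s_eq: "s = (\<Sum>(a, b)\<in>{..<L} \<times> {..<L}. z ^ (a + b) *\<^sub>C (T ^^ (2 * L - 2 - (a + b))) x)"
  proof -
    have "s = (\<Sum>a<L. \<Sum>b<L. z ^ (a + b) *\<^sub>C (T ^^ ((L - 1 - a) + (L - 1 - b))) x)"
      by (simp add: s_def u_def truncated_resolvent_def bounded_clinear_sum[OF Tn]
          bounded_clinear_scaleC[OF Tn] fp complex_vector.scale_sum_right scaleC_scaleC power_add)
    also have "\<dots> = (\<Sum>a<L. \<Sum>b<L. z ^ (a + b) *\<^sub>C (T ^^ (2 * L - 2 - (a + b))) x)"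
    proof (intro sum.cong refl)
      fix a b assume "a \<in> {..<L}" "b \<in> {..<L}"
      then have "(L - 1 - a) + (L - 1 - b) = 2 * L - 2 - (a + b)" by auto
      then show "z ^ (a + b) *\<^sub>C (T ^^ ((L - 1 - a) + (L - 1 - b))) x
          = z ^ (a + b) *\<^sub>C (T ^^ (2 * L - 2 - (a + b))) x" by simp
    qed
    finally show ?thesis by (simp add: sum.cartesian_product)
  qed
  have sV: "s \<in> V"
    unfolding s_eq using x
    by (intro complex_vector.subspace_sum[OF V]) (auto intro!: complex_vector.subspace_scale[OF V])
  have "w = (\<Sum>b<L. z ^ b *\<^sub>C ((T ^^ (L + (L - 1 - b))) x - z ^ L *\<^sub>C (T ^^ (L - 1 - b)) x))"
    by (simp add: w_def u_def truncated_resolvent_def bounded_clinear_sum[OF Tn] bounded_clinear_scaleC[OF Tn]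
        complex_vector.scale_sum_right complex_vector.scale_right_diff_distrib sum_subtractf fp scaleC_scaleC mult.commute)
  then have wV: "w \<in> V"
    using x by (auto intro!: complex_vector.subspace_sum[OF V] complex_vector.subspace_scale[OF V]
        complex_vector.subspace_diff[OF V])
  have "T s - z *\<^sub>C s = w"
    unfolding s_def w_def by (rule truncated_resolvent_telescope[OF T])
  then have 1: "c * norm s \<le> norm w" using below[OF sV] by simp
  have "T w - z *\<^sub>C w = (T ^^ L) (T u - z *\<^sub>C u) - z ^ L *\<^sub>C (T u - z *\<^sub>C u)"
    by (simp add: w_def comm bounded_clinear_diff[OF T] bounded_clinear_diff[OF Tn] bounded_clinear_scaleC[OF T]
        bounded_clinear_scaleC[OF Tn] complex_vector.scale_right_diff_distrib scaleC_scaleC algebra_simps)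
  also have "T u - z *\<^sub>C u = (T ^^ L) x - z ^ L *\<^sub>C x"
    unfolding u_def by (rule truncated_resolvent_telescope[OF T])
  also have "(T ^^ L) ((T ^^ L) x - z ^ L *\<^sub>C x) - z ^ L *\<^sub>C ((T ^^ L) x - z ^ L *\<^sub>C x)
      = (T ^^ (2 * L)) x - (2 * z ^ L) *\<^sub>C (T ^^ L) x + z ^ (2 * L) *\<^sub>C x"
    unfolding bounded_clinear_diff[OF Tn] bounded_clinear_scaleC[OF Tn] fp mult_2 scaleC_add_left power_add
      complex_vector.scale_right_diff_distrib scaleC_scaleC by simp
  finally have 2: "c * norm w \<le> norm ((T ^^ (2 * L)) x - (2 * z ^ L) *\<^sub>C (T ^^ L) x + z ^ (2 * L) *\<^sub>C x)"
    using below[OF wV] by simp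
  have "c\<^sup>2 * norm s \<le> c * norm w"
    using mult_left_mono[OF 1, of c] \<open>c > 0\<close> by (simp add: power2_eq_square mult.assoc)
  also note 2
  also have "norm ((T ^^ (2 * L)) x - (2 * z ^ L) *\<^sub>C (T ^^ L) x + z ^ (2 * L) *\<^sub>C x)
      \<le> norm ((T ^^ (2 * L)) x) + norm ((2 * z ^ L) *\<^sub>C (T ^^ L) x) + norm (z ^ (2 * L) *\<^sub>C x)"
    by (intro norm_triangle_le[OF add_right_mono[OF norm_triangle_ineq4]])
  finally show ?thesis by (simp add: s_eq norm_scaleC norm_mult norm_power)
qed

text \<open>Cauchy's estimate for the coefficient of \<open>z ^ (L - 1)\<close>. It arises from \<open>L\<close> pairs of exponents,
  whence the factor \<open>L\<close>, which can be made to outweigh the constant \<open>2\<close> on the right.\<close>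

lemma middle_iterate_bound:
  assumes T: "bounded_clinear T" and V: "csubspace V"
    and below: "\<And>y z. y \<in> V \<Longrightarrow> norm z \<le> 1 \<Longrightarrow> c * norm y \<le> norm (T y - z *\<^sub>C y)" and "c > 0"
    and x: "\<And>i. i < 2 * L \<Longrightarrow> (T ^^ i) x \<in> V" and "L > 0" and \<rho>: "0 \<le> \<rho>" "\<rho> \<le> 1"
  shows "real L * c\<^sup>2 * (\<rho> ^ (L - 1) * norm ((T ^^ (L - 1)) x))
    \<le> norm ((T ^^ (2 * L)) x) + 2 * \<rho> ^ L * norm ((T ^^ L) x) + \<rho> ^ (2 * L) * norm x" (is "_ \<le> ?R")
proof -
  let ?I = "{..<L} \<times> {..<L}"
  let ?v = "\<lambda>(a, b). (T ^^ (2 * L - 2 - (a + b))) x"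
  have c2: "c\<^sup>2 > 0" using \<open>c > 0\<close> by simp
  have "norm (\<Sum>i\<in>?I. z ^ (fst i + snd i) *\<^sub>C ?v i) \<le> ?R / c\<^sup>2" if "norm z = \<rho>" for z
    using truncated_resolvent_square_bound[OF T V below \<open>c > 0\<close> x, of z] that \<rho> c2
    by (simp add: split_beta field_simps)
  then have "\<rho> ^ (L - 1) * norm (\<Sum>i | i \<in> ?I \<and> fst i + snd i = L - 1. ?v i) \<le> ?R / c\<^sup>2"
    using \<open>L > 0\<close> \<rho> by (intro norm_coefficient_le[where m = "2 * L"]) auto
  also have "(\<Sum>i | i \<in> ?I \<and> fst i + snd i = L - 1. ?v i) = (\<Sum>a<L. (T ^^ (L - 1)) x)"
    by (rule sum.reindex_bij_witness[where i = "\<lambda>a. (a, L - 1 - a)" and j = fst])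
      (use \<open>L > 0\<close> in \<open>auto simp: mult_2\<close>)
  finally show ?thesis using c2 by (simp add: field_simps sum_constant_scaleR)
qed

text \<open>If \<open>a (k + 1) \<ge> s * a k\<close>, then the choice \<open>\<sigma> = min (2 * s) 1\<close> in the quadratic inequality gives
  \<open>a (k + 2) \<ge> min (4 * s) 2 * a (k + 1)\<close>.\<close>

lemma ratio_growth:
  fixes a :: "nat \<Rightarrow> real"
  assumes pos: "\<And>k. a k \<ge> 0" and d: "d > 0" "d * a 0 \<le> a 1"
    and quad: "\<And>k \<sigma>. k + 2 \<le> n \<Longrightarrow> 0 \<le> \<sigma> \<Longrightarrow> \<sigma> \<le> 1 \<Longrightarrow> 4 * \<sigma> * a (k + 1) \<le> a (k + 2) + \<sigma>\<^sup>2 * a k"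
  shows "k < n \<Longrightarrow> min (4 ^ k * d) 2 * a k \<le> a (k + 1)"
proof (induction k)
  case 0
  have "min d 2 * a 0 \<le> d * a 0" using pos by (intro mult_right_mono) auto
  then show ?case using d(2) by simp
next
  case (Suc k)
  define s where "s = min (4 ^ k * d) 2"
  define \<sigma> where "\<sigma> = min (2 * s) 1"
  have s: "s > 0" using d(1) by (simp add: s_def)
  have IH: "s * a k \<le> a (k + 1)" using Suc by (simp add: s_def)
  have \<sigma>: "\<sigma> \<ge> 0" "\<sigma> \<le> 1" using s by (auto simp: \<sigma>_def)
  have "\<sigma>\<^sup>2 * a k \<le> \<sigma>\<^sup>2 * (a (k + 1) / s)"
    using IH s by (intro mult_left_mono) (simp_all add: field_simps)
  then have "(4 * \<sigma> - \<sigma>\<^sup>2 / s) * a (k + 1) \<le> a (k + 2)"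
    using quad[of k \<sigma>] Suc.prems \<sigma> by (simp add: algebra_simps)
  moreover have "min (4 * s) 2 \<le> 4 * \<sigma> - \<sigma>\<^sup>2 / s"
  proof (cases "2 * s \<le> 1")
    case True
    then have "\<sigma> = 2 * s" by (simp add: \<sigma>_def)
    then show ?thesis using s by (simp add: power2_eq_square)
  next
    case False
    then have "\<sigma> = 1" by (simp add: \<sigma>_def)
    moreover have "1 / s < 2" using False s by (simp add: field_simps)
    ultimately show ?thesis by simp
  qed
  then have "min (4 * s) 2 * a (k + 1) \<le> (4 * \<sigma> - \<sigma>\<^sup>2 / s) * a (k + 1)"
    using pos by (intro mult_right_mono)
  moreover have "min (4 ^ Suc k * d) 2 = min (4 * s) 2"
  proof -
    define t where "t = 4 ^ k * d"
    have t: "4 ^ Suc k * d = 4 * t" "s = min t 2" by (simp_all add: t_def s_def)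
    show ?thesis unfolding t by (simp add: min_def)
  qed
  ultimately show ?case by simp
qed

text \<open>The constant \<open>K\<close> depends on \<open>d\<close> only, not on the sequence nor on the range of validity \<open>n\<close> of the
  hypothesis.\<close>

lemma exponential_growth:
  fixes d :: real
  assumes d: "d > 0"
  obtains K where "K > 0" "\<And>a n k. (\<And>k. a k \<ge> 0) \<Longrightarrow> d * a 0 \<le> a 1 \<Longrightarrow>
     (\<And>k \<sigma>. k + 2 \<le> n \<Longrightarrow> 0 \<le> \<sigma> \<Longrightarrow> \<sigma> \<le> 1 \<Longrightarrow> 4 * \<sigma> * a (k + 1) \<le> a (k + 2) + \<sigma>\<^sup>2 * a k) \<Longrightarrow>
     k \<le> n \<Longrightarrow> K * 2 ^ k * a 0 \<le> (a k :: real)"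
proof -
  obtain m where "2 / d < 4 ^ m" using real_arch_pow[of 4 "2 / d"] by auto
  then have m: "2 \<le> 4 ^ k * d" if "k \<ge> m" for k
  proof -
    have "2 \<le> 4 ^ m * d" using \<open>2 / d < 4 ^ m\<close> d by (simp add: field_simps)
    also have "\<dots> \<le> 4 ^ k * d" using d that by (intro mult_right_mono power_increasing) auto
    finally show ?thesis .
  qed
  define e where "e = min d 2"
  have e: "e > 0" "e \<le> 2" using d by (auto simp: e_def)
  have "(e / 2) ^ m * 2 ^ k * a 0 \<le> a k"
    if pos: "\<And>k. a k \<ge> 0" and "d * a 0 \<le> a 1"
      and "\<And>k \<sigma>. k + 2 \<le> n \<Longrightarrow> 0 \<le> \<sigma> \<Longrightarrow> \<sigma> \<le> 1 \<Longrightarrow> 4 * \<sigma> * a (k + 1) \<le> a (k + 2) + \<sigma>\<^sup>2 * a k"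
      and "k \<le> n" for a :: "nat \<Rightarrow> real" and n k
  proof -
    have step: "min (4 ^ k * d) 2 * a k \<le> a (k + 1)" if "k < n" for k
      using ratio_growth[of a d n k] \<open>k < n\<close> that d \<open>d * a 0 \<le> a 1\<close> pos
        \<open>\<And>k \<sigma>. k + 2 \<le> n \<Longrightarrow> 0 \<le> \<sigma> \<Longrightarrow> \<sigma> \<le> 1 \<Longrightarrow> 4 * \<sigma> * a (k + 1) \<le> a (k + 2) + \<sigma>\<^sup>2 * a k\<close> by blast
    have "(e / 2) ^ min k m * 2 ^ k * a 0 \<le> a k" using \<open>k \<le> n\<close>
    proof (induction k)
      case (Suc k)
      then have IH: "(e / 2) ^ min k m * 2 ^ k * a 0 \<le> a k" by simp
      show ?case
      proof (cases "k < m")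
        case True
        have "d \<le> 4 ^ k * d" using d by simp
        then have "e \<le> min (4 ^ k * d) 2" by (auto simp: e_def)
        then have "e * a k \<le> a (Suc k)"
          using step[of k] Suc.prems mult_right_mono[OF _ pos, of e "min (4 ^ k * d) 2" k] by simp
        moreover have "e * ((e / 2) ^ min k m * 2 ^ k * a 0) \<le> e * a k"
          using IH e by (intro mult_left_mono) auto
        moreover have "min k m = k" "min (Suc k) m = Suc k" using True by auto
        ultimately show ?thesis by (simp add: field_simps)
      next
        case False
        then have "2 * a k \<le> a (Suc k)" using step[of k] m[of k] Suc.prems by simp
        moreover have "min k m = m" "min (Suc k) m = m" using False by auto
        ultimately show ?thesis using IH by simp
      qed
    qed simp
    moreover have "(e / 2) ^ m \<le> (e / 2) ^ min k m"
      using e by (intro power_decreasing) auto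
    then have "(e / 2) ^ m * 2 ^ k * a 0 \<le> (e / 2) ^ min k m * 2 ^ k * a 0"
      using pos by (intro mult_right_mono) auto
    ultimately show ?thesis by linarith
  qed
  moreover have "(e / 2) ^ m > 0" using e by simp
  ultimately show ?thesis using that by blast
qed

text \<open>Lower bounds are stable under small perturbations of \<open>z\<close>, so finitely many \<open>z\<close> suffice to cover the
  closed unit disk.\<close>

lemma uniform_bounded_below:
  fixes T :: "'a::complex_banach \<Rightarrow> 'a"
  assumes T: "bounded_clinear T"
    and F: "\<And>z. norm z \<le> 1 \<Longrightarrow> left_Fredholm (\<lambda>x. T x - z *\<^sub>C x)"
  obtains \<Phi> :: "('a \<Rightarrow> complex) set" and c where "finite \<Phi>" "\<And>\<phi>. \<phi> \<in> \<Phi> \<Longrightarrow> bounded_clinear \<phi>"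
    "c > 0" "\<And>x z. x \<in> joint_kernel \<Phi> \<Longrightarrow> norm z \<le> 1 \<Longrightarrow> c * norm x \<le> norm (T x - z *\<^sub>C x)"
proof -
  have "\<exists>\<Phi> c. finite \<Phi> \<and> (\<forall>\<phi>\<in>\<Phi>. bounded_clinear \<phi>) \<and> c > 0 \<and>
      (\<forall>x\<in>joint_kernel \<Phi>. c * norm x \<le> norm (T x - z *\<^sub>C x))" if "norm z \<le> 1" for z
  proof -
    have "bounded_clinear (\<lambda>x. T x - z *\<^sub>C x)"
      by (rule bounded_clinear_diff_op[OF T bounded_clinear_scaleC_right])
    from left_Fredholm_bounded_below[OF this F[OF that]] show ?thesis by metis
  qed
  then obtain \<Phi> :: "complex \<Rightarrow> ('a \<Rightarrow> complex) set" and c where \<Phi>: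
    "\<And>z. norm z \<le> 1 \<Longrightarrow> finite (\<Phi> z)" "\<And>z \<phi>. norm z \<le> 1 \<Longrightarrow> \<phi> \<in> \<Phi> z \<Longrightarrow> bounded_clinear \<phi>"
    "\<And>z. norm z \<le> 1 \<Longrightarrow> c z > 0"
    "\<And>z x. norm z \<le> 1 \<Longrightarrow> x \<in> joint_kernel (\<Phi> z) \<Longrightarrow> c z * norm x \<le> norm (T x - z *\<^sub>C x)"
    by metis
  obtain C where C: "C \<subseteq> cball 0 1" "finite C" "cball 0 1 \<subseteq> (\<Union>z\<in>C. ball z (c z / 2))"
  proof (rule compactE_image[of "cball (0::complex) 1" "cball 0 1" "\<lambda>z. ball z (c z / 2)"])
    show "cball 0 1 \<subseteq> (\<Union>z\<in>cball 0 1. ball z (c z / 2))" using \<Phi>(3) by force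
  qed (auto intro: that)
  have "C \<noteq> {}" using C(3) by force
  define d where "d = Min (c ` C) / 2"
  have d: "d > 0" "\<And>z. z \<in> C \<Longrightarrow> d \<le> c z / 2"
    using C(1,2) \<open>C \<noteq> {}\<close> \<Phi>(3) by (auto simp: d_def subset_iff)
  have "d * norm x \<le> norm (T x - w *\<^sub>C x)"
    if x: "x \<in> joint_kernel (\<Union>z\<in>C. \<Phi> z)" and w: "norm w \<le> 1" for x w
  proof -
    obtain z where z: "z \<in> C" "dist z w < c z / 2" using C(3) w by force
    have "norm z \<le> 1" using z(1) C(1) by auto
    moreover have "x \<in> joint_kernel (\<Phi> z)" using x z(1) by (auto simp: joint_kernel_def)
    ultimately have "c z * norm x \<le> norm (T x - z *\<^sub>C x)" by (rule \<Phi>(4))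
    also have "T x - z *\<^sub>C x = (T x - w *\<^sub>C x) - (z - w) *\<^sub>C x"
      by (simp add: complex_vector.scale_left_diff_distrib)
    also have "norm \<dots> \<le> norm (T x - w *\<^sub>C x) + norm (z - w) * norm x"
      by (metis norm_scaleC norm_triangle_ineq4)
    also have "\<dots> \<le> norm (T x - w *\<^sub>C x) + c z / 2 * norm x"
      using z(2) by (intro add_left_mono mult_right_mono) (auto simp: dist_norm)
    finally have "c z / 2 * norm x \<le> norm (T x - w *\<^sub>C x)" by simp
    then show ?thesis using mult_right_mono[OF d(2)[OF z(1)], of "norm x"] by simp
  qed
  moreover have C1: "norm z \<le> 1" if "z \<in> C" for z using C(1) that by auto
  have "finite (\<Union>z\<in>C. \<Phi> z)" using C(2) C1 \<Phi>(1) by blast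
  moreover have "bounded_clinear \<phi>" if "\<phi> \<in> (\<Union>z\<in>C. \<Phi> z)" for \<phi>
    using that C1 \<Phi>(2) by blast
  ultimately show ?thesis using that[of "\<Union>z\<in>C. \<Phi> z" d] d(1) by blast
qed

text \<open>The functionals in \<open>\<Psi> n\<close> keep the orbit of \<open>x\<close> up to time \<open>L * (n + 1)\<close> in the subspace on which
  all the operators \<open>T - z\<close> are bounded below.\<close>

lemma funpow_growth_finite_codim:
  fixes T :: "'a::complex_banach \<Rightarrow> 'a"
  assumes T: "bounded_clinear T"
    and F: "\<And>z. norm z \<le> 1 \<Longrightarrow> left_Fredholm (\<lambda>x. T x - z *\<^sub>C x)"
  obtains L K and \<Psi> :: "nat \<Rightarrow> ('a \<Rightarrow> complex) set" where "L > 0" "K > 0"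
    "\<And>n. finite (\<Psi> n)" "\<And>n \<phi>. \<phi> \<in> \<Psi> n \<Longrightarrow> bounded_clinear \<phi>"
    "\<And>n x. x \<in> joint_kernel (\<Psi> n) \<Longrightarrow> K * 2 ^ n * norm x \<le> norm ((T ^^ (L * n)) x)"
proof -
  obtain \<Phi> :: "('a \<Rightarrow> complex) set" and c where \<Phi>: "finite \<Phi>" "\<And>\<phi>. \<phi> \<in> \<Phi> \<Longrightarrow> bounded_clinear \<phi>"
    and c: "c > 0" "\<And>x z. x \<in> joint_kernel \<Phi> \<Longrightarrow> norm z \<le> 1 \<Longrightarrow> c * norm x \<le> norm (T x - z *\<^sub>C x)"
    using uniform_bounded_below[OF T F] by metis
  let ?V = "joint_kernel \<Phi>"
  have V: "csubspace ?V" by (rule csubspace_joint_kernel[OF \<Phi>(2)])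
  have Tn: "bounded_clinear (T ^^ n)" for n by (rule bounded_clinear_funpow[OF T])
  have fp: "(T ^^ i) ((T ^^ j) y) = (T ^^ (i + j)) y" for i j y by (simp add: funpow_add)
  obtain B where B: "B > 0" "\<And>x. norm (T x) \<le> norm x * B"
    using bounded_clinear_bounded[OF T] by blast
  \<comment> \<open>Of the 6 obtained here, 2 are absorbed by the middle term of the estimate and 4 remain.\<close>
  obtain L where "6 * B / c\<^sup>2 < real L" using reals_Archimedean2 by blast
  then have L6: "6 * B \<le> real L * c\<^sup>2" using c(1) by (simp add: field_simps)
  have "L > 0" using L6 B(1) by (cases L) auto
  have quad: "4 * \<sigma> * norm ((T ^^ L) y) \<le> norm ((T ^^ (2 * L)) y) + \<sigma>\<^sup>2 * norm y"
    if y: "\<And>i. i < 2 * L \<Longrightarrow> (T ^^ i) y \<in> ?V" and \<sigma>: "0 \<le> \<sigma>" "\<sigma> \<le> 1" for \<sigma> y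
  proof -
    \<comment> \<open>The radius is chosen so that \<open>\<rho> ^ L = \<sigma>\<close>.\<close>
    define \<rho> where "\<rho> = root L \<sigma>"
    have \<rho>: "0 \<le> \<rho>" "\<rho> \<le> 1" and \<rho>L: "\<rho> ^ L = \<sigma>"
      using \<sigma> \<open>L > 0\<close> by (simp_all add: \<rho>_def)
    have \<rho>2L: "\<rho> ^ (2 * L) = \<sigma>\<^sup>2" by (simp add: \<rho>L mult.commute[of 2] power_mult)
    have "(T ^^ L) y = T ((T ^^ (L - 1)) y)" using \<open>L > 0\<close> by (cases L) auto
    then have "norm ((T ^^ L) y) \<le> B * norm ((T ^^ (L - 1)) y)"
      using B(2) by (simp add: mult.commute)
    then have "\<sigma> * norm ((T ^^ L) y) \<le> \<rho> ^ (L - 1) * (B * norm ((T ^^ (L - 1)) y))"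
      using \<rho> \<sigma> unfolding \<rho>L[symmetric] by (intro mult_mono power_decreasing) auto
    then have "6 * (\<sigma> * norm ((T ^^ L) y)) \<le> 6 * B * (\<rho> ^ (L - 1) * norm ((T ^^ (L - 1)) y))"
      by (simp add: algebra_simps)
    also have "\<dots> \<le> real L * c\<^sup>2 * (\<rho> ^ (L - 1) * norm ((T ^^ (L - 1)) y))"
      using L6 \<rho> by (intro mult_right_mono) auto
    also have "\<dots> \<le> norm ((T ^^ (2 * L)) y) + 2 * \<rho> ^ L * norm ((T ^^ L) y) + \<rho> ^ (2 * L) * norm y"
      using middle_iterate_bound[OF T V c(2) c(1) y \<open>L > 0\<close> \<rho>] by simp
    finally show ?thesis unfolding \<rho>L \<rho>2L by simp
  qed
  obtain K where K: "K > 0" "\<And>a n k. (\<And>k. a k \<ge> 0) \<Longrightarrow> c ^ L * a 0 \<le> a 1 \<Longrightarrow>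
     (\<And>k \<sigma>. k + 2 \<le> n \<Longrightarrow> 0 \<le> \<sigma> \<Longrightarrow> \<sigma> \<le> 1 \<Longrightarrow> 4 * \<sigma> * a (k + 1) \<le> a (k + 2) + \<sigma>\<^sup>2 * a k) \<Longrightarrow>
     k \<le> n \<Longrightarrow> K * 2 ^ k * a 0 \<le> (a k :: real)"
    using exponential_growth[of "c ^ L"] c(1) by (metis zero_less_power)
  define \<Psi> where "\<Psi> n = (\<lambda>(\<phi>, i) x. \<phi> ((T ^^ i) x)) ` (\<Phi> \<times> {..L * (n + 1)})" for n
  have "K * 2 ^ n * norm x \<le> norm ((T ^^ (L * n)) x)" if x: "x \<in> joint_kernel (\<Psi> n)" for n x
  proof -
    have orb: "(T ^^ i) x \<in> ?V" if "i \<le> L * (n + 1)" for i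
      using x that by (force simp: joint_kernel_def \<Psi>_def)
    have "c ^ i * norm x \<le> norm ((T ^^ i) x)" if "i \<le> L * (n + 1)" for i using that
    proof (induction i)
      case (Suc i)
      then have "c * (c ^ i * norm x) \<le> c * norm ((T ^^ i) x)" using c(1) by (intro mult_left_mono) auto
      also have "\<dots> \<le> norm ((T ^^ Suc i) x)" using c(2)[OF orb, of i 0] Suc.prems by simp
      finally show ?case by (simp add: mult.assoc)
    qed simp
    from this[of L] have "c ^ L * norm ((T ^^ (L * 0)) x) \<le> norm ((T ^^ (L * 1)) x)" by simp
    moreover have "4 * \<sigma> * norm ((T ^^ (L * (k + 1))) x) \<le> norm ((T ^^ (L * (k + 2))) x) + \<sigma>\<^sup>2 * norm ((T ^^ (L * k)) x)"
      if "k + 2 \<le> n" "0 \<le> \<sigma>" "\<sigma> \<le> 1" for k \<sigma>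
    proof -
      have "(T ^^ i) ((T ^^ (L * k)) x) \<in> ?V" if "i < 2 * L" for i
      proof -
        have "i + L * k \<le> L * (k + 2)" using that by (simp add: algebra_simps)
        also have "\<dots> \<le> L * (n + 1)" using \<open>k + 2 \<le> n\<close> by (intro mult_left_mono) auto
        finally show ?thesis using orb by (simp add: fp)
      qed
      moreover have "L + L * k = L * (k + 1)" "2 * L + L * k = L * (k + 2)"
        by (simp_all add: algebra_simps)
      ultimately show ?thesis using quad[of "(T ^^ (L * k)) x" \<sigma>] that(2,3) by (simp only: fp)
    qed
    ultimately show ?thesis
      using K(2)[of "\<lambda>k. norm ((T ^^ (L * k)) x)" n n] by simp
  qed
  moreover have "finite (\<Psi> n)" for n using \<Phi>(1) by (simp add: \<Psi>_def)
  moreover have "bounded_clinear \<phi>" if "\<phi> \<in> \<Psi> n" for \<phi> n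
    using that \<Phi>(2) by (auto simp: \<Psi>_def intro: bounded_clinear_compose[OF _ Tn])
  ultimately show ?thesis using that \<open>L > 0\<close> K(1) by blast
qed

text \<open>A gliding hump: the vector is a series of terms \<open>y n\<close> of norm \<open>(2/3) ^ n\<close>, small enough to be summable
  and large enough for \<open>2 ^ n * (2/3) ^ n\<close> to tend to infinity. A functional \<open>\<phi> n\<close> detects the growth
  of \<open>(T ^^ (L * n)) (y n)\<close>; later terms are chosen invisible to it, and the sign of \<open>y n\<close> is chosen
  so that earlier terms do not cancel it.\<close>

lemma orbit_tends_to_infinity:
  fixes T :: "'a::complex_banach \<Rightarrow> 'a"
  assumes T: "bounded_clinear T"
    and F: "\<And>z. norm z \<le> 1 \<Longrightarrow> left_Fredholm (\<lambda>x. T x - z *\<^sub>C x)"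
    and M: "inf_dim_closed_csubspace M"
  obtains x where "x \<in> M" "filterlim (\<lambda>n. norm ((T ^^ n) x)) at_top sequentially"
proof -
  have csM: "csubspace M" and clM: "closed M" and infM: "\<not> cfinite_dim M"
    using M by (auto simp: inf_dim_closed_csubspace_def)
  obtain L K and \<Psi> :: "nat \<Rightarrow> ('a \<Rightarrow> complex) set" where "L > 0" "K > 0"
    and \<Psi>: "\<And>n. finite (\<Psi> n)" "\<And>n \<phi>. \<phi> \<in> \<Psi> n \<Longrightarrow> bounded_clinear \<phi>"
    "\<And>n x. x \<in> joint_kernel (\<Psi> n) \<Longrightarrow> K * 2 ^ n * norm x \<le> norm ((T ^^ (L * n)) x)"
    using funpow_growth_finite_codim[OF T F] by metis
  define U where "U n = T ^^ (L * n)" for n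
  have U: "bounded_clinear (U n)" for n unfolding U_def by (rule bounded_clinear_funpow[OF T])
  \<comment> \<open>The requirement on the \<open>n\<close>-th pair of term and functional, given the earlier pairs.\<close>
  define P where "P f n r \<longleftrightarrow> (case r of (y, \<phi>) \<Rightarrow> y \<in> M \<and> norm y = (2/3) ^ n \<and>
      (\<forall>i<n. snd (f i) (U i y) = 0) \<and> bounded_clinear \<phi> \<and> (\<forall>v. norm (\<phi> v) \<le> 2 * norm v) \<and>
      K * (4/3) ^ n \<le> norm (\<phi> (U n ((\<Sum>i<n. fst (f i)) + y))))"
    for f :: "nat \<Rightarrow> 'a \<times> ('a \<Rightarrow> complex)" and n and r :: "'a \<times> ('a \<Rightarrow> complex)"
  have "\<exists>f. \<forall>n. P f n (f n)"
  proof (rule dependent_wf_choice[OF wf_less_than])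
    show "P f n r = P g n r" if "\<And>z. (z, n) \<in> less_than \<Longrightarrow> f z = g z" for f g n r
      using that by (auto simp: P_def)
  next
    fix n f assume IH: "\<And>i. (i, n) \<in> less_than \<Longrightarrow> P f i (f i)"
    define \<Phi> where "\<Phi> = \<Psi> n \<union> (\<lambda>i x. snd (f i) (U i x)) ` {..<n}"
    have fin: "finite \<Phi>" using \<Psi>(1) by (simp add: \<Phi>_def)
    have "bounded_clinear (snd (f i))" if "i < n" for i
      using IH[of i] that by (auto simp: P_def split: prod.splits)
    then have "bounded_clinear (\<lambda>x. snd (f i) (U i x))" if "i < n" for i
      using that by (intro bounded_clinear_compose[OF _ U])
    then have bd: "bounded_clinear \<phi>" if "\<phi> \<in> \<Phi>" for \<phi>
      using that \<Psi>(2) by (auto simp: \<Phi>_def)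
    have csK: "csubspace (M \<inter> joint_kernel \<Phi>)"
      using csM csubspace_joint_kernel[OF bd] by (intro complex_vector.subspace_inter)
    obtain x0 where x0: "x0 \<in> M \<inter> joint_kernel \<Phi>" "x0 \<noteq> 0"
      using not_cfinite_dim_nonzero[OF not_cfinite_dim_joint_kernel[OF fin bd infM csM] csK] by blast
    define y0 where "y0 = complex_of_real ((2/3) ^ n / norm x0) *\<^sub>C x0"
    have y0: "y0 \<in> M \<inter> joint_kernel \<Phi>" unfolding y0_def by (rule complex_vector.subspace_scale[OF csK x0(1)])
    have ny0: "norm y0 = (2/3) ^ n"
      unfolding y0_def norm_scaleC norm_of_real using x0(2) by simp
    have "y0 \<in> joint_kernel (\<Psi> n)" using y0 by (auto simp: joint_kernel_def \<Phi>_def)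
    from \<Psi>(3)[OF this] have "K * (2 ^ n * (2/3) ^ n) \<le> norm (U n y0)" by (simp add: ny0 U_def mult.assoc)
    then have Uy0: "K * (4/3) ^ n \<le> norm (U n y0)" by (simp flip: power_mult_distrib)
    obtain \<phi> :: "'a \<Rightarrow> complex" where \<phi>: "bounded_clinear \<phi>" "\<And>v. norm (\<phi> v) \<le> 2 * norm v"
      "Re (\<phi> (U n y0)) = norm (U n y0)"
      using norming_functional[of "U n y0"] by blast
    define p where "p = \<phi> (U n (\<Sum>i<n. fst (f i)))"
    define b where "b = \<phi> (U n y0)"
    have b: "K * (4/3) ^ n \<le> norm b" using Uy0 \<phi>(3) complex_Re_le_cmod[of b] by (simp add: b_def)
    \<comment> \<open>One of the two signs avoids cancellation with the contribution \<open>p\<close> of the earlier terms.\<close>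
    have "norm (2 * b) \<le> norm (p + b) + norm (p - b)"
      using norm_triangle_ineq4[of "p + b" "p - b"] by simp
    then consider "norm b \<le> norm (p + b)" | "norm b \<le> norm (p - b)" by (force simp: norm_mult)
    then obtain y where y: "y = y0 \<or> y = - y0" "norm b \<le> norm (\<phi> (U n ((\<Sum>i<n. fst (f i)) + y)))"
    proof cases
      case 1
      then show ?thesis using that[of y0] by (simp add: p_def b_def bounded_clinear_add[OF U] bounded_clinear_add[OF \<phi>(1)])
    next
      case 2
      then show ?thesis using that[of "- y0"]
        by (simp add: p_def b_def bounded_clinear_diff[OF U] bounded_clinear_diff[OF \<phi>(1)])
    qed
    have "y \<in> M \<inter> joint_kernel \<Phi>" using y(1) y0 complex_vector.subspace_neg[OF csK y0] by auto
    moreover from this have "\<forall>i<n. snd (f i) (U i y) = 0" by (auto simp: joint_kernel_def \<Phi>_def)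
    moreover have "norm y = (2/3) ^ n" using y(1) ny0 by auto
    ultimately have "P f n (y, \<phi>)" using \<phi>(1,2) y(2) b by (auto simp: P_def)
    then show "\<exists>r. P f n r" by blast
  qed
  then obtain f where f: "\<And>n. P f n (f n)" by blast
  define y where "y n = fst (f n)" for n
  define \<phi> where "\<phi> n = snd (f n)" for n
  have y: "y n \<in> M" "norm (y n) = (2/3) ^ n" and zero: "i < n \<Longrightarrow> \<phi> i (U i (y n)) = 0"
    and \<phi>: "bounded_clinear (\<phi> n)" "norm (\<phi> n v) \<le> 2 * norm v"
    and big: "K * (4/3) ^ n \<le> norm (\<phi> n (U n ((\<Sum>i<n. y i) + y n)))" for n i v
    using f[of n] by (auto simp: P_def y_def \<phi>_def split: prod.splits)
  have "summable (\<lambda>n. norm (y n))" unfolding y(2) by (rule summable_geometric) simp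
  then have sumy: "summable y" by (rule summable_norm_cancel)
  define x where "x = suminf y"
  have lim: "(\<lambda>N. \<Sum>i<N. y i) \<longlonglongrightarrow> x" unfolding x_def by (rule summable_LIMSEQ[OF sumy])
  have "x \<in> M"
    by (rule closed_sequentially[OF clM complex_vector.subspace_sum[OF csM y(1)] lim])
  have Ux: "K / 2 * (4/3) ^ n \<le> norm (U n x)" for n
  proof -
    have "(\<lambda>N. \<phi> n (U n (\<Sum>i<N. y i))) \<longlonglongrightarrow> \<phi> n (U n x)"
      by (intro bounded_clinear_tendsto[OF \<phi>(1)] bounded_clinear_tendsto[OF U] lim)
    moreover have "\<phi> n (U n (\<Sum>i<N. y i)) = \<phi> n (U n ((\<Sum>i<n. y i) + y n))" if "N \<ge> Suc n" for N
      using that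
    proof (induction N rule: dec_induct)
      case (step N)
      then show ?case using zero[of n N]
        by (simp add: bounded_clinear_add[OF U] bounded_clinear_add[OF \<phi>(1)])
    qed simp
    then have "(\<lambda>N. \<phi> n (U n (\<Sum>i<N. y i))) \<longlonglongrightarrow> \<phi> n (U n ((\<Sum>i<n. y i) + y n))"
      by (intro tendsto_eventually) (auto simp: eventually_sequentially)
    ultimately have "\<phi> n (U n x) = \<phi> n (U n ((\<Sum>i<n. y i) + y n))" by (rule LIMSEQ_unique)
    then have "K * (4/3) ^ n \<le> 2 * norm (U n x)" using big[of n] \<phi>(2)[of n "U n x"] by simp
    then show ?thesis by simp
  qed
  obtain B where B: "B \<ge> 1" "\<And>x. norm (T x) \<le> B * norm x"
  proof -
    obtain B where "B > 0" "\<And>x. norm (T x) \<le> norm x * B" using bounded_clinear_bounded[OF T] by blast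
    then have "norm (T x) \<le> max B 1 * norm x" for x
      using mult_left_mono[of B "max B 1" "norm x"] by (simp add: mult.commute) (meson max.cobounded1 norm_ge_zero order_trans)
    then show ?thesis using that[of "max B 1"] by simp
  qed
  have pw: "norm ((T ^^ i) v) \<le> B ^ i * norm v" for i v
  proof (induction i)
    case (Suc i)
    have "norm ((T ^^ Suc i) v) \<le> B * norm ((T ^^ i) v)" using B(2) by simp
    also have "\<dots> \<le> B * (B ^ i * norm v)" using Suc B(1) by (intro mult_left_mono) auto
    finally show ?case by (simp add: mult.assoc)
  qed simp
  \<comment> \<open>Growth along multiples of \<open>L\<close> passes to all exponents by going up to the next multiple.\<close>
  have low: "K / 2 / B ^ L * (4/3) ^ (m div L) \<le> norm ((T ^^ m) x)" for m
  proof -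
    define n where "n = Suc (m div L)"
    have m: "L * n = (L - m mod L) + m"
    proof -
      have "m mod L < L" "L * (m div L) + m mod L = m" using \<open>L > 0\<close> by simp_all
      moreover have "L * n = L + L * (m div L)" by (simp add: n_def)
      ultimately show ?thesis by linarith
    qed
    have "K / 2 * (4/3) ^ (m div L) \<le> K / 2 * (4/3) ^ n"
      using \<open>K > 0\<close> by (intro mult_left_mono power_increasing) (auto simp: n_def)
    also have "\<dots> \<le> norm ((T ^^ (L - m mod L)) ((T ^^ m) x))"
      using Ux[of n] by (simp add: U_def m funpow_add)
    also have "\<dots> \<le> B ^ (L - m mod L) * norm ((T ^^ m) x)" by (rule pw)
    also have "\<dots> \<le> B ^ L * norm ((T ^^ m) x)"
      using B(1) by (intro mult_right_mono power_increasing) auto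
    finally show ?thesis using B(1) by (simp add: field_simps)
  qed
  have "filterlim (\<lambda>m. m div L) sequentially sequentially"
    unfolding filterlim_at_top
  proof
    fix Z
    have "m div L \<ge> Z" if "m \<ge> Z * L" for m
      using div_le_mono[OF that, of L] \<open>L > 0\<close> by simp
    then show "\<forall>\<^sub>F m in sequentially. Z \<le> m div L" unfolding eventually_sequentially by blast
  qed
  moreover have "filterlim (\<lambda>n. K / 2 / B ^ L * (4/3) ^ n) at_top sequentially"
  proof (rule filterlim_tendsto_pos_mult_at_top[OF tendsto_const])
    show "0 < K / 2 / B ^ L" using \<open>K > 0\<close> B(1) by simp
    show "filterlim (\<lambda>n. (4/3 :: real) ^ n) at_top sequentially"
      by (intro filterlim_at_infinity_imp_filterlim_at_top filterlim_realpow_sequentially_gt1 always_eventually) auto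
  qed
  ultimately have "filterlim (\<lambda>m. K / 2 / B ^ L * (4/3) ^ (m div L)) at_top sequentially"
    using filterlim_compose by blast
  then have "filterlim (\<lambda>n. norm ((T ^^ n) x)) at_top sequentially"
    by (rule filterlim_at_top_mono) (use low in auto)
  then show ?thesis using that \<open>x \<in> M\<close> by blast
qed

section \<open>A common dense subspace of convergence\<close>

text \<open>A property that holds for arbitrarily large \<open>n\<close> at every precision \<open>N\<close> holds along a subsequence with
  increasing precision.\<close>

lemma strict_mono_selection:
  fixes Q :: "nat \<Rightarrow> nat \<Rightarrow> bool"
  assumes ex: "\<And>N. \<exists>n\<ge>N. Q N n" and mono: "\<And>M N n. M \<le> N \<Longrightarrow> Q N n \<Longrightarrow> Q M n"
  obtains r where "strict_mono r" "\<And>j. Q j (r j)"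
proof -
  obtain pick where pick: "\<And>N. pick N \<ge> N" "\<And>N. Q N (pick N)" using ex by metis
  define r where "r = rec_nat (pick 0) (\<lambda>_ n. pick (Suc n))"
  have r: "r 0 = pick 0" "r (Suc j) = pick (Suc (r j))" for j by (simp_all add: r_def)
  have sm: "strict_mono r"
    unfolding strict_mono_Suc_iff r(2) using pick(1) Suc_le_lessD by blast
  have "Q j (r j)" for j
  proof (cases j)
    case 0
    then show ?thesis using pick(2)[of 0] by (simp add: r)
  next
    case (Suc i)
    have "j \<le> Suc (r i)" using seq_suble[OF sm, of i] Suc by simp
    then show ?thesis using mono pick(2)[of "Suc (r i)"] unfolding Suc r(2) by blast
  qed
  with sm show ?thesis by (rule that)
qed

text \<open>Density in the topology of pointwise convergence.\<close>

lemma closure_UNIV_fun: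
  fixes A :: "(nat \<Rightarrow> 'a::metric_space) set"
  assumes "\<And>f. \<exists>F. (\<forall>i. F i \<in> A) \<and> (\<forall>k. (\<lambda>i. F i k) \<longlonglongrightarrow> f k)"
  shows "closure A = UNIV"
proof -
  have "f \<in> closure A" for f
  proof -
    obtain F where F: "\<And>i. F i \<in> A" "\<And>k. (\<lambda>i. F i k) \<longlonglongrightarrow> f k" using assms by blast
    have "limitin (product_topology (\<lambda>_. euclidean) UNIV) F f sequentially"
      using F(2) by (simp add: limitin_componentwise)
    then have "F \<longlonglongrightarrow> f"
      by (simp add: euclidean_product_topology)
    then show ?thesis using F(1) closure_sequential by blast
  qed
  then show ?thesis by blast
qed

text \<open>For each \<open>l\<close> the set of convergence is dense, but these sets may have trivial intersection. For a
  generic sequence \<open>f\<close> of vectors, however, the powers along \<open>\<omega> l\<close> come close to \<open>g l\<close> simultaneously on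
  any finite part of \<open>f\<close>, for every \<open>l\<close>, and \<open>f\<close> has dense range. Passing to subsequences gives
  convergence on the span of \<open>f\<close>.\<close>

lemma common_dense_subspace:
  fixes T :: "'a::complex_banach \<Rightarrow> 'a"
  assumes sep: "separable_space (euclidean :: 'a topology)" and T: "bounded_clinear T"
    and g: "\<And>l. g l \<in> Omega_ops T"
  shows "\<exists>D \<psi>. csubspace D \<and> closure D = UNIV \<and>
    (\<forall>l :: nat. pos_strict_mono (\<psi> l) \<and> (\<forall>x\<in>D. (\<lambda>n. (T ^^ \<psi> l n) x) \<longlonglongrightarrow> g l x))"
proof -
  have gb: "bounded_clinear (g l)" for l using g[of l] by (simp add: Omega_ops_def cont_clinear_ops_iff)
  have Tn: "bounded_clinear (T ^^ n)" for n by (rule bounded_clinear_funpow[OF T])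
  have "\<forall>l. \<exists>\<omega>. pos_strict_mono \<omega> \<and> closure {x. (\<lambda>n. (T ^^ \<omega> n) x) \<longlonglongrightarrow> g l x} = UNIV"
    using g by (auto simp: Omega_ops_def)
  then obtain \<omega> where \<omega>: "\<And>l. pos_strict_mono (\<omega> l)"
    "\<And>l. closure {x. (\<lambda>n. (T ^^ \<omega> l n) x) \<longlonglongrightarrow> g l x} = UNIV" by metis
  obtain C :: "'a set" where C: "countable C" "closure C = UNIV"
    using sep by (auto simp: separable_space_def)
  \<comment> \<open>\<open>G l N\<close> asks for a good approximation to \<open>g l\<close> on the first \<open>N\<close> entries; the sets \<open>H x n\<close> with \<open>x\<close> in
    \<open>C\<close> ensure dense range.\<close>
  define err where "err l n x = norm ((T ^^ \<omega> l n) x - g l x)" for l n x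
  define G where "G l N = {f. \<exists>n\<ge>N. \<forall>k<N. err l n (f k) < 1 / real (Suc N)}" for l N
  define H where "H x n = {f :: nat \<Rightarrow> 'a. \<exists>k. dist (f k) x < 1 / real (Suc n)}" for x :: 'a and n
  define \<G> where "\<G> = range (\<lambda>(l, N). G l N) \<union> (\<lambda>(x, n). H x n) ` (C \<times> UNIV)"
  have coord: "continuous_on UNIV (\<lambda>f :: nat \<Rightarrow> 'a. f k)" for k
    by (rule continuous_on_product_then_coordinatewise[OF continuous_on_id])
  have coordT: "continuous_on UNIV (\<lambda>f :: nat \<Rightarrow> 'a. (T ^^ n) (f k))" for n k
    by (rule continuous_on_compose2[OF bounded_clinear_continuous_on[OF Tn, of UNIV] coord]) simp
  have coordg: "continuous_on UNIV (\<lambda>f :: nat \<Rightarrow> 'a. g l (f k))" for l k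
    by (rule continuous_on_compose2[OF bounded_clinear_continuous_on[OF gb, of UNIV] coord]) simp
  have op_err: "open {f :: nat \<Rightarrow> 'a. err l n (f k) < e}" for l n k e
    unfolding err_def
    by (intro open_Collect_less continuous_on_norm continuous_on_diff continuous_on_const coordT coordg)
  have openG: "open (G l N)" for l N
  proof -
    have "G l N = (\<Union>n\<in>{N..}. \<Inter>k\<in>{..<N}. {f. err l n (f k) < 1 / real (Suc N)})"
      by (auto simp: G_def)
    then show ?thesis by (simp only:) (intro open_UN open_INT ballI op_err finite_lessThan)
  qed
  have openH: "open (H x n)" for x n
  proof -
    have "H x n = (\<Union>k. {f. dist (f k) x < 1 / real (Suc n)})" by (auto simp: H_def)
    moreover have "open {f :: nat \<Rightarrow> 'a. dist (f k) x < 1 / real (Suc n)}" for k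
      by (intro open_Collect_less continuous_on_dist coord continuous_on_const)
    ultimately show ?thesis by (simp only:) (intro open_UN ballI)
  qed
  have denseG: "closure (G l N) = UNIV" for l N
  proof (rule closure_UNIV_fun)
    fix f :: "nat \<Rightarrow> 'a"
    let ?X = "{x. (\<lambda>n. (T ^^ \<omega> l n) x) \<longlonglongrightarrow> g l x}"
    have "\<forall>k. \<exists>F. (\<forall>i. F i \<in> ?X) \<and> F \<longlonglongrightarrow> f k"
      using \<omega>(2)[of l] unfolding closure_sequential[symmetric] by blast
    then obtain F where F: "\<And>k i. F k i \<in> ?X" "\<And>k. F k \<longlonglongrightarrow> f k" by metis
    have "(\<lambda>k. F k i) \<in> G l N" for i
    proof -
      have "\<forall>\<^sub>F n in sequentially. err l n (F k i) < 1 / real (Suc N)" for k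
      proof -
        have "(\<lambda>n. (T ^^ \<omega> l n) (F k i)) \<longlonglongrightarrow> g l (F k i)" using F(1)[of k i] by simp
        from tendstoD[OF this, of "1 / real (Suc N)"] show ?thesis by (simp add: err_def dist_norm)
      qed
      then have "\<forall>\<^sub>F n in sequentially. \<forall>k\<in>{..<N}. err l n (F k i) < 1 / real (Suc N)"
        by (intro eventually_ball_finite) auto
      then obtain n0 where "\<And>n. n \<ge> n0 \<Longrightarrow> \<forall>k\<in>{..<N}. err l n (F k i) < 1 / real (Suc N)"
        unfolding eventually_sequentially by blast
      from this[of "max n0 N"] show ?thesis by (auto simp: G_def intro!: exI[of _ "max n0 N"])
    qed
    then show "\<exists>F. (\<forall>i. F i \<in> G l N) \<and> (\<forall>k. (\<lambda>i. F i k) \<longlonglongrightarrow> f k)"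
      using F(2) by (intro exI[of _ "\<lambda>i k. F k i"]) auto
  qed
  have denseH: "closure (H x n) = UNIV" for x n
  proof (rule closure_UNIV_fun)
    fix f :: "nat \<Rightarrow> 'a"
    define F where "F i k = (if k < i then f k else x)" for i k
    have "F i \<in> H x n" for i by (auto simp: H_def F_def intro!: exI[of _ i])
    moreover have "(\<lambda>i. F i k) \<longlonglongrightarrow> f k" for k
      by (rule tendsto_eventually)
        (auto simp: F_def eventually_sequentially intro!: exI[of _ "Suc k"])
    ultimately show "\<exists>F. (\<forall>i. F i \<in> H x n) \<and> (\<forall>k. (\<lambda>i. F i k) \<longlonglongrightarrow> f k)" by blast
  qed
  have "euclidean closure_of \<Inter>\<G> = topspace (euclidean :: (nat \<Rightarrow> 'a) topology)"
  proof (rule Baire_category)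
    show "completely_metrizable_space (euclidean :: (nat \<Rightarrow> 'a) topology) \<or>
        locally_compact_space (euclidean :: (nat \<Rightarrow> 'a) topology) \<and> regular_space (euclidean :: (nat \<Rightarrow> 'a) topology)"
      using completely_metrizable_space_euclidean by blast
    show "countable \<G>" using C(1) by (simp add: \<G>_def)
    show "openin euclidean U \<and> euclidean closure_of U = topspace euclidean" if "U \<in> \<G>" for U
      using that openG openH denseG denseH by (auto simp: \<G>_def)
  qed
  then have "closure (\<Inter>\<G>) = UNIV" by simp
  then have "\<Inter>\<G> \<noteq> {}" by (metis closure_empty empty_not_UNIV)
  then obtain f where "f \<in> \<Inter>\<G>" by blast
  then have fG: "f \<in> G l N" and fH: "x \<in> C \<Longrightarrow> f \<in> H x n" for l N x n
    by (auto simp: \<G>_def)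
  have "\<exists>r. strict_mono r \<and> (\<forall>j. \<forall>k<j. err l (r j) (f k) < 1 / real (Suc j))" for l
  proof -
    have "\<exists>n\<ge>N. \<forall>k<N. err l n (f k) < 1 / real (Suc N)" for N using fG[of l N] by (simp add: G_def)
    moreover have "\<forall>k<M. err l n (f k) < 1 / real (Suc M)"
      if "M \<le> N" "\<forall>k<N. err l n (f k) < 1 / real (Suc N)" for M N n
    proof (intro allI impI)
      fix k assume "k < M"
      then have "err l n (f k) < 1 / real (Suc N)" using that by auto
      also have "\<dots> \<le> 1 / real (Suc M)" using that(1) by (simp add: frac_le)
      finally show "err l n (f k) < 1 / real (Suc M)" .
    qed
    ultimately show ?thesis
      using strict_mono_selection[of "\<lambda>N n. \<forall>k<N. err l n (f k) < 1 / real (Suc N)"] by metis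
  qed
  then obtain r where r: "\<And>l. strict_mono (r l)" "\<And>l j k. k < j \<Longrightarrow> err l (r l j) (f k) < 1 / real (Suc j)"
    by metis
  define \<psi> where "\<psi> l n = \<omega> l (r l n)" for l n
  have \<psi>: "pos_strict_mono (\<psi> l)" for l
    using \<omega>(1)[of l] r(1)[of l] by (auto simp: pos_strict_mono_def \<psi>_def strict_mono_def)
  define A where "A = {x. \<forall>l. (\<lambda>n. (T ^^ \<psi> l n) x) \<longlonglongrightarrow> g l x}"
  have csA: "csubspace A"
    unfolding A_def
    by (rule csubspaceI) (auto simp: bounded_clinear_zero[OF Tn] bounded_clinear_zero[OF gb]
        bounded_clinear_add[OF Tn] bounded_clinear_add[OF gb] bounded_clinear_scaleC[OF Tn]
        bounded_clinear_scaleC[OF gb] intro!: tendsto_add tendsto_scaleC)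
  have "f k \<in> A" for k
  proof -
    have "(\<lambda>n. (T ^^ \<psi> l n) (f k) - g l (f k)) \<longlonglongrightarrow> 0" for l
    proof (rule Lim_null_comparison)
      show "\<forall>\<^sub>F n in sequentially. norm ((T ^^ \<psi> l n) (f k) - g l (f k)) \<le> 1 / real (Suc n)"
        unfolding eventually_sequentially
        using r(2)[of k _ l] by (intro exI[of _ "Suc k"]) (auto simp: err_def \<psi>_def intro: less_imp_le)
      show "(\<lambda>n. 1 / real (Suc n)) \<longlonglongrightarrow> 0" using LIMSEQ_Suc[OF lim_1_over_n] by simp
    qed
    then show ?thesis by (simp add: A_def LIM_zero_iff)
  qed
  then have "range f \<subseteq> A" by blast
  have "closure (range f) = UNIV"
  proof -
    have "C \<subseteq> closure (range f)"
    proof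
      fix x assume "x \<in> C"
      show "x \<in> closure (range f)"
        unfolding closure_approachable
      proof (intro allI impI)
        fix e :: real assume "e > 0"
        then obtain n where "1 / real (Suc n) < e" using nat_approx_posE by metis
        moreover obtain k where "dist (f k) x < 1 / real (Suc n)" using fH[OF \<open>x \<in> C\<close>, of n] by (auto simp: H_def)
        ultimately have "dist (f k) x < e" by linarith
        then show "\<exists>y\<in>range f. dist y x < e" by blast
      qed
    qed
    then show ?thesis using C(2) closure_minimal[of C "closure (range f)"] by auto
  qed
  then have "closure (range f) \<subseteq> closure A" "closure (range f) = UNIV"
    using closure_mono[OF \<open>range f \<subseteq> A\<close>] by auto
  then have "closure A = UNIV" by blast
  moreover have "(\<lambda>n. (T ^^ \<psi> l n) x) \<longlonglongrightarrow> g l x" if "x \<in> A" for l x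
    using that by (simp add: A_def)
  ultimately show ?thesis using csA \<psi> by (intro exI[of _ A] exI[of _ \<psi>]) blast
qed

section \<open>Subspaces spanned by basic sequences\<close>

text \<open>Uniformly bounded operators that tend to 0 pointwise on a subspace do so on its closure.\<close>

lemma bounded_clinear_null_on_closure:
  assumes A: "\<And>n. bounded_clinear (A n)"
    and bd: "\<And>n y. y \<in> W \<Longrightarrow> norm (A n y) \<le> C * norm y"
    and null: "\<And>y. y \<in> W \<Longrightarrow> (\<lambda>n. A n y) \<longlonglongrightarrow> 0"
    and W: "csubspace W" and x: "x \<in> closure W"
  shows "norm (A n x) \<le> C * norm x" and "(\<lambda>n. A n x) \<longlonglongrightarrow> 0"
proof -
  have bd': "norm (A n y) \<le> C * norm y" if "y \<in> closure W" for n y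
  proof -
    have "closed {y. norm (A n y) \<le> C * norm y}"
      by (intro closed_Collect_le continuous_on_norm bounded_clinear_continuous_on[OF A]
          continuous_on_mult_left continuous_on_id)
    moreover have "W \<subseteq> {y. norm (A n y) \<le> C * norm y}" using bd by blast
    ultimately show ?thesis using closure_minimal that by blast
  qed
  show "norm (A n x) \<le> C * norm x" by (rule bd'[OF x])
  define K where "K = max C 1"
  have K: "K > 0" "C \<le> K" by (auto simp: K_def)
  show "(\<lambda>n. A n x) \<longlonglongrightarrow> 0"
  proof (rule LIMSEQ_I)
    fix e :: real assume "e > 0"
    then obtain y where y: "y \<in> W" "dist y x < e / (2 * K)"
      using x K(1) unfolding closure_approachable by (meson divide_pos_pos mult_pos_pos zero_less_numeral)
    obtain N where N: "\<And>n. n \<ge> N \<Longrightarrow> norm (A n y) < e / 2"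
      using LIMSEQ_D[OF null[OF y(1)], of "e / 2"] \<open>e > 0\<close> by auto
    have "norm (A n x) < e" if "n \<ge> N" for n
    proof -
      have "x - y \<in> closure W"
        using y(1) closure_subset x by (intro complex_vector.subspace_diff[OF csubspace_closure[OF W]]) auto
      then have "norm (A n (x - y)) \<le> C * norm (x - y)" by (rule bd')
      also have "\<dots> \<le> K * norm (x - y)" using K(2) by (intro mult_right_mono) auto
      also have "\<dots> \<le> e / 2" using y(2) K(1) by (simp add: dist_norm norm_minus_commute field_simps)
      finally have "norm (A n (x - y)) \<le> e / 2" .
      moreover have "A n x = A n (x - y) + A n y" by (simp add: bounded_clinear_diff[OF A])
      ultimately show ?thesis
        using N[OF that] norm_triangle_ineq[of "A n (x - y)" "A n y"] by simp
    qed
    then show "\<exists>no. \<forall>n\<ge>no. norm (A n x - 0) < e" by auto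
  qed
qed

lemma cspan_range_expansion:
  fixes e :: "nat \<Rightarrow> 'a::complex_normed_vector"
  assumes "y \<in> cspan (range e)"
  obtains b N where "\<And>i. i \<ge> N \<Longrightarrow> b i = 0" "\<And>n. n \<ge> N \<Longrightarrow> y = (\<Sum>i<n. b i *\<^sub>C e i)"
proof -
  have "\<exists>b N. (\<forall>i\<ge>N. b i = 0) \<and> (\<forall>n\<ge>N. y = (\<Sum>i<n. b i *\<^sub>C e i))"
    using assms
  proof (induction rule: complex_vector.span_induct_alt)
    case base
    show ?case by (rule exI[of _ "\<lambda>_. 0"]) simp
  next
    case (step c x y)
    then obtain j b N where x: "x = e j" and b: "\<And>i. i \<ge> N \<Longrightarrow> b i = 0"
      "\<And>n. n \<ge> N \<Longrightarrow> y = (\<Sum>i<n. b i *\<^sub>C e i)" by blast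
    define b' where "b' i = (if i = j then c else 0) + b i" for i
    have "c *\<^sub>C x + y = (\<Sum>i<n. b' i *\<^sub>C e i)" if "n \<ge> max N (Suc j)" for n
    proof -
      have "(\<Sum>i<n. b' i *\<^sub>C e i) = (\<Sum>i<n. if i = j then c *\<^sub>C e j else 0) + (\<Sum>i<n. b i *\<^sub>C e i)"
        unfolding b'_def scaleC_add_left sum.distrib by (intro arg_cong2[of _ _ _ _ "(+)"] sum.cong) auto
      then show ?thesis using that b(2)[of n] x by simp
    qed
    moreover have "b' i = 0" if "i \<ge> max N (Suc j)" for i using that b(1) by (auto simp: b'_def)
    ultimately show ?case by blast
  qed
  then show ?thesis using that by blast
qed

text \<open>The vectors of a normalised sequence with bounded coefficient functionals are uniformly separated, so
  they cannot lie in a compact set.\<close>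

lemma basic_sequence_not_cfinite_dim:
  fixes e :: "nat \<Rightarrow> 'a::complex_banach"
  assumes ne: "\<And>i. norm (e i) = 1"
    and coeff: "\<And>b i N. i < N \<Longrightarrow> norm (b i) \<le> 8 * norm (\<Sum>j<N. b j *\<^sub>C e j)"
    and sub: "range e \<subseteq> V"
  shows "\<not> cfinite_dim V"
proof
  assume "cfinite_dim V"
  then obtain B where B: "finite B" "cspan B = V" by (auto simp: cfinite_dim_def)
  have sep: "1 / 8 \<le> dist (e i) (e j)" if "i < j" for i j
  proof -
    define b where "b k = (if k = j then 1 else if k = i then -1 else 0 :: complex)" for k
    have "(\<Sum>k<Suc j. b k *\<^sub>C e k) = e j + (\<Sum>k<j. b k *\<^sub>C e k)"
      by (simp add: b_def scaleC_of_real[of 1, simplified])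
    also have "(\<Sum>k<j. b k *\<^sub>C e k) = (\<Sum>k<j. if k = i then - e i else 0)"
      by (intro sum.cong refl) (auto simp: b_def scaleC_of_real[of 1, simplified])
    also have "\<dots> = - e i" using that by simp
    finally have "(\<Sum>k<Suc j. b k *\<^sub>C e k) = e j - e i" by simp
    then have "1 \<le> 8 * norm (e j - e i)" using coeff[of j "Suc j" b] by (simp add: b_def)
    then show ?thesis by (simp add: dist_norm norm_minus_commute)
  qed
  have "e i \<in> cspan B \<inter> cball 0 1" for i using sub ne B(2) by auto
  moreover have "seq_compact (cspan B \<inter> cball 0 1)"
    using compact_cspan_finite[OF B(1)] by (simp add: compact_imp_seq_compact)
  ultimately obtain l r where r: "strict_mono (r :: nat \<Rightarrow> nat)" "(e \<circ> r) \<longlonglongrightarrow> l"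
    unfolding seq_compact_def by metis
  then have "Cauchy (e \<circ> r)" by (simp add: LIMSEQ_imp_Cauchy)
  then obtain N where "\<And>m n. m \<ge> N \<Longrightarrow> n \<ge> N \<Longrightarrow> dist ((e \<circ> r) m) ((e \<circ> r) n) < 1 / 8"
    using metric_CauchyD[of "e \<circ> r" "1 / 8"] by auto
  from this[of N "Suc N"] sep[of "r N" "r (Suc N)"] r(1) show False
    by (simp add: strict_mono_Suc_iff)
qed

lemma basic_coefficient_bound:
  fixes e :: "nat \<Rightarrow> 'a::complex_normed_vector"
  assumes ne: "\<And>i. norm (e i) = 1"
    and basic: "\<And>b m N. m \<le> N \<Longrightarrow> norm (\<Sum>j<m. b j *\<^sub>C e j) \<le> 4 * norm (\<Sum>j<N. b j *\<^sub>C e j)"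
    and "i < N"
  shows "norm (b i) \<le> 8 * norm (\<Sum>j<N. b j *\<^sub>C e j)"
proof -
  have "b i *\<^sub>C e i = (\<Sum>j<Suc i. b j *\<^sub>C e j) - (\<Sum>j<i. b j *\<^sub>C e j)" by simp
  then have "norm (b i) \<le> norm (\<Sum>j<Suc i. b j *\<^sub>C e j) + norm (\<Sum>j<i. b j *\<^sub>C e j)"
    by (metis mult.right_neutral ne norm_scaleC norm_triangle_ineq4)
  then show ?thesis using basic[of "Suc i" N b] basic[of i N b] \<open>i < N\<close> by simp
qed

lemma iterate_minus_power_bound:
  assumes T: "bounded_clinear T"
  obtains C where "C > 0" "\<And>x. norm ((T ^^ n) x - z ^ n *\<^sub>C x) \<le> C * norm (T x - z *\<^sub>C x)"
proof -
  obtain B where B: "B > 0" "\<And>x. norm (T x) \<le> norm x * B" using bounded_clinear_bounded[OF T] by blast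
  have "\<exists>C>0. \<forall>x. norm ((T ^^ n) x - z ^ n *\<^sub>C x) \<le> C * norm (T x - z *\<^sub>C x)"
  proof (induction n)
    case 0
    show ?case by (rule exI[of _ 1]) (simp add: scaleC_of_real[of 1, simplified])
  next
    case (Suc n)
    then obtain C where C: "C > 0" "\<And>x. norm ((T ^^ n) x - z ^ n *\<^sub>C x) \<le> C * norm (T x - z *\<^sub>C x)" by blast
    have "norm ((T ^^ Suc n) x - z ^ Suc n *\<^sub>C x) \<le> (C * B + norm z ^ n) * norm (T x - z *\<^sub>C x)" for x
    proof -
      have "(T ^^ Suc n) x - z ^ Suc n *\<^sub>C x = T ((T ^^ n) x - z ^ n *\<^sub>C x) + z ^ n *\<^sub>C (T x - z *\<^sub>C x)"
        by (simp add: bounded_clinear_diff[OF T] bounded_clinear_scaleC[OF T]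
            complex_vector.scale_right_diff_distrib scaleC_scaleC mult.commute)
      then have "norm ((T ^^ Suc n) x - z ^ Suc n *\<^sub>C x)
          \<le> norm (T ((T ^^ n) x - z ^ n *\<^sub>C x)) + norm z ^ n * norm (T x - z *\<^sub>C x)"
        using norm_triangle_ineq norm_scaleC norm_power by metis
      also have "norm (T ((T ^^ n) x - z ^ n *\<^sub>C x)) \<le> norm ((T ^^ n) x - z ^ n *\<^sub>C x) * B" by (rule B(2))
      also have "\<dots> \<le> C * norm (T x - z *\<^sub>C x) * B" using C(2) B(1) by (intro mult_right_mono) auto
      finally show ?thesis by (simp add: algebra_simps)
    qed
    moreover have "C * B + norm z ^ n > 0" using C(1) B(1) by (intro add_pos_nonneg) auto
    ultimately show ?case by blast
  qed
  then show ?thesis using that by blast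
qed

text \<open>Besides the inequality characterising basic sequences, each \<open>e k\<close> is an almost eigenvector of
  the earlier powers \<open>T ^^ p i\<close>, and \<open>T ^^ p k\<close> almost agrees with \<open>g k\<close> on the vectors chosen so far. In the
  recursion \<open>\<Phi> B\<close> is a finite set of functionals norming the span of \<open>B\<close>, and \<open>e k\<close> is taken in the
  joint kernel of the functionals belonging to all earlier initial segments.\<close>

lemma adapted_basic_sequence:
  fixes T :: "'a::complex_banach \<Rightarrow> 'a"
  assumes T: "bounded_clinear T" and nF: "\<not> left_Fredholm (\<lambda>x. T x - z *\<^sub>C x)"
    and D: "csubspace D" "closure D = UNIV"
    and \<psi>: "\<And>k. strict_mono (\<psi> k)" "\<And>k x. x \<in> D \<Longrightarrow> (\<lambda>n. (T ^^ \<psi> k n) x) \<longlonglongrightarrow> g k x"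
  shows "\<exists>e p. (\<forall>i. norm (e i) = 1) \<and> pos_strict_mono p \<and>
    (\<forall>b m N. m \<le> N \<longrightarrow> norm (\<Sum>j<m. b j *\<^sub>C e j) \<le> 4 * norm (\<Sum>j<N. b j *\<^sub>C e j)) \<and>
    (\<forall>i k. i < k \<longrightarrow> norm ((T ^^ p i) (e k) - z ^ p i *\<^sub>C e k) \<le> (1/2) ^ k) \<and>
    (\<forall>i k. i \<le> k \<longrightarrow> norm ((T ^^ p k) (e i) - g k (e i)) \<le> (1/2) ^ k / real (Suc k))"
proof -
  define S where "S x = T x - z *\<^sub>C x" for x
  have S: "bounded_clinear S"
    unfolding S_def by (rule bounded_clinear_diff_op[OF T bounded_clinear_scaleC_right])
  have "\<exists>\<Phi> :: ('a \<Rightarrow> complex) set. finite B \<longrightarrow> finite \<Phi> \<and> (\<forall>\<phi>\<in>\<Phi>. bounded_clinear \<phi>) \<and>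
      (\<forall>v\<in>cspan B. \<forall>w\<in>joint_kernel \<Phi>. norm v \<le> 4 * norm (v + w))" for B :: "'a set"
    using finite_dim_norming[of B] by metis
  then obtain \<Phi> :: "'a set \<Rightarrow> ('a \<Rightarrow> complex) set" where \<Phi>: "\<And>B. finite B \<Longrightarrow> finite (\<Phi> B)"
    "\<And>B \<phi>. finite B \<Longrightarrow> \<phi> \<in> \<Phi> B \<Longrightarrow> bounded_clinear \<phi>"
    "\<And>B v w. finite B \<Longrightarrow> v \<in> cspan B \<Longrightarrow> w \<in> joint_kernel (\<Phi> B) \<Longrightarrow> norm v \<le> 4 * norm (v + w)"
    by metis
  \<comment> \<open>The requirement on the \<open>k\<close>-th pair of vector and exponent, given the earlier pairs.\<close>
  define P where "P f k r \<longleftrightarrow> (case r of (x, q) \<Rightarrow> x \<in> D \<and> norm x = 1 \<and>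
      (\<forall>i\<le>k. x \<in> joint_kernel (\<Phi> ((\<lambda>j. fst (f j)) ` {..<i}))) \<and>
      (\<forall>i<k. norm ((T ^^ snd (f i)) x - z ^ snd (f i) *\<^sub>C x) \<le> (1/2) ^ k) \<and>
      (\<forall>i<k. snd (f i) < q) \<and> 0 < q \<and>
      (\<forall>i<k. norm ((T ^^ q) (fst (f i)) - g k (fst (f i))) \<le> (1/2) ^ k / real (Suc k)) \<and>
      norm ((T ^^ q) x - g k x) \<le> (1/2) ^ k / real (Suc k))"
    for f :: "nat \<Rightarrow> 'a \<times> nat" and k and r :: "'a \<times> nat"
  have "\<exists>f. \<forall>k. P f k (f k)"
  proof (rule dependent_wf_choice[OF wf_less_than])
    fix f f' :: "nat \<Rightarrow> 'a \<times> nat" and k r assume eq: "\<And>i. (i, k) \<in> less_than \<Longrightarrow> f i = f' i"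
    have "(\<lambda>j. fst (f j)) ` {..<i} = (\<lambda>j. fst (f' j)) ` {..<i}" if "i \<le> k" for i
      using eq that by (intro image_cong) auto
    then show "P f k r = P f' k r"
      using eq by (auto simp: P_def)
  next
    fix k and f :: "nat \<Rightarrow> 'a \<times> nat" assume IH: "\<And>i. (i, k) \<in> less_than \<Longrightarrow> P f i (f i)"
    have fD: "fst (f i) \<in> D" if "i < k" for i using IH[of i] that by (auto simp: P_def split: prod.splits)
    define \<Theta> where "\<Theta> = (\<Union>i\<le>k. \<Phi> ((\<lambda>j. fst (f j)) ` {..<i}))"
    have "finite \<Theta>" using \<Phi>(1) by (simp add: \<Theta>_def)
    moreover have "bounded_clinear \<phi>" if "\<phi> \<in> \<Theta>" for \<phi>
    proof -
      have "\<exists>i. \<phi> \<in> \<Phi> ((\<lambda>j. fst (f j)) ` {..<i})" using that unfolding \<Theta>_def by blast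
      then obtain i where "\<phi> \<in> \<Phi> ((\<lambda>j. fst (f j)) ` {..<i})" ..
      then show ?thesis by (rule \<Phi>(2)[OF finite_imageI[OF finite_lessThan]])
    qed
    ultimately have \<Theta>: "finite \<Theta>" "\<And>\<phi>. \<phi> \<in> \<Theta> \<Longrightarrow> bounded_clinear \<phi>" by blast+
    have "\<exists>C>0. \<forall>x. norm ((T ^^ n) x - z ^ n *\<^sub>C x) \<le> C * norm (S x)" for n
      using iterate_minus_power_bound[OF T, of n z] unfolding S_def by metis
    then obtain c where c: "\<And>n. c n > 0" "\<And>n x. norm ((T ^^ n) x - z ^ n *\<^sub>C x) \<le> c n * norm (S x)"
      by metis
    define \<delta> where "\<delta> = (1/2) ^ k / (1 + (\<Sum>i<k. c (snd (f i))))"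
    have den: "1 + (\<Sum>i<k. c (snd (f i))) > 0"
      using sum_nonneg[of "{..<k}" "\<lambda>i. c (snd (f i))"] c(1) by (smt (verit) less_imp_le)
    then have "\<delta> > 0" by (simp add: \<delta>_def)
    obtain x where x: "x \<in> D \<inter> joint_kernel \<Theta>" "norm x = 1" "norm (S x) < \<delta>"
      using not_left_Fredholm_small_vector[OF S _ \<Theta> D \<open>\<delta> > 0\<close>] nF unfolding S_def by blast
    have near: "norm ((T ^^ snd (f i)) x - z ^ snd (f i) *\<^sub>C x) \<le> (1/2) ^ k" if "i < k" for i
    proof -
      have "norm ((T ^^ snd (f i)) x - z ^ snd (f i) *\<^sub>C x) \<le> c (snd (f i)) * norm (S x)" by (rule c(2))
      also have "\<dots> \<le> (1 + (\<Sum>i<k. c (snd (f i)))) * \<delta>"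
      proof (rule mult_mono)
        have "c (snd (f i)) \<le> (\<Sum>i<k. c (snd (f i)))"
          using that c(1) by (intro member_le_sum) (auto intro: less_imp_le)
        then show "c (snd (f i)) \<le> 1 + (\<Sum>i<k. c (snd (f i)))" by simp
      qed (use x(3) den in auto)
      also have "\<dots> = (1/2) ^ k" using den by (simp add: \<delta>_def)
      finally show ?thesis .
    qed
    have ev: "\<forall>\<^sub>F n in sequentially. norm ((T ^^ \<psi> k n) y - g k y) \<le> (1/2) ^ k / real (Suc k)" if "y \<in> D" for y
    proof -
      have "(1/2) ^ k / real (Suc k) > 0" by simp
      from tendstoD[OF \<psi>(2)[OF that, of k] this] show ?thesis
        unfolding dist_norm by (rule eventually_mono) (rule less_imp_le)
    qed
    have "\<forall>\<^sub>F n in sequentially. \<forall>y\<in>insert x ((\<lambda>i. fst (f i)) ` {..<k}). norm ((T ^^ \<psi> k n) y - g k y) \<le> (1/2) ^ k / real (Suc k)"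
      using ev fD x(1) by (intro eventually_ball_finite) auto
    moreover have "\<forall>\<^sub>F n in sequentially. \<psi> k n > (\<Sum>i<k. snd (f i))"
    proof -
      have "filterlim (\<psi> k) at_top sequentially" by (rule filterlim_subseq[OF \<psi>(1)])
      then show ?thesis by (rule eventually_compose_filterlim[OF eventually_gt_at_top])
    qed
    ultimately have "\<forall>\<^sub>F n in sequentially. (\<forall>y\<in>insert x ((\<lambda>i. fst (f i)) ` {..<k}).
        norm ((T ^^ \<psi> k n) y - g k y) \<le> (1/2) ^ k / real (Suc k)) \<and> \<psi> k n > (\<Sum>i<k. snd (f i))"
      by (rule eventually_conj)
    then obtain n where n: "\<And>y. y \<in> insert x ((\<lambda>i. fst (f i)) ` {..<k}) \<Longrightarrow>
        norm ((T ^^ \<psi> k n) y - g k y) \<le> (1/2) ^ k / real (Suc k)" "\<psi> k n > (\<Sum>i<k. snd (f i))"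
      unfolding eventually_sequentially by blast
    have "snd (f i) < \<psi> k n" if "i < k" for i
      using n(2) member_le_sum[of i "{..<k}" "\<lambda>i. snd (f i)"] that by simp
    moreover have "x \<in> joint_kernel (\<Phi> ((\<lambda>j. fst (f j)) ` {..<i}))" if "i \<le> k" for i
      using x(1) that by (auto simp: \<Theta>_def joint_kernel_def)
    ultimately have "P f k (x, \<psi> k n)"
      using x near n by (auto simp: P_def)
    then show "\<exists>r. P f k r" by blast
  qed
  then obtain f where f: "\<And>k. P f k (f k)" by blast
  define e where "e k = fst (f k)" for k
  define p where "p k = snd (f k)" for k
  have e: "norm (e k) = 1" and ker: "i \<le> k \<Longrightarrow> e k \<in> joint_kernel (\<Phi> (e ` {..<i}))"
    and near: "i < k \<Longrightarrow> norm ((T ^^ p i) (e k) - z ^ p i *\<^sub>C e k) \<le> (1/2) ^ k"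
    and p: "i < k \<Longrightarrow> p i < p k" "0 < p k"
    and conv: "i < k \<Longrightarrow> norm ((T ^^ p k) (e i) - g k (e i)) \<le> (1/2) ^ k / real (Suc k)"
      "norm ((T ^^ p k) (e k) - g k (e k)) \<le> (1/2) ^ k / real (Suc k)" for i k
    using f[of k] by (auto simp: P_def e_def[abs_def] p_def split: prod.splits)
  have "norm (\<Sum>j<m. b j *\<^sub>C e j) \<le> 4 * norm (\<Sum>j<N. b j *\<^sub>C e j)" if "m \<le> N" for b m N
  proof -
    have fin: "finite (e ` {..<m})" by simp
    have "(\<Sum>j<m. b j *\<^sub>C e j) \<in> cspan (e ` {..<m})"
      by (intro complex_vector.span_sum complex_vector.span_scale complex_vector.span_base) auto
    moreover have "(\<Sum>j\<in>{m..<N}. b j *\<^sub>C e j) \<in> joint_kernel (\<Phi> (e ` {..<m}))"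
      using csubspace_joint_kernel[OF \<Phi>(2)[OF fin]] ker
      by (intro complex_vector.subspace_sum complex_vector.subspace_scale) auto
    ultimately have "norm (\<Sum>j<m. b j *\<^sub>C e j) \<le> 4 * norm ((\<Sum>j<m. b j *\<^sub>C e j) + (\<Sum>j\<in>{m..<N}. b j *\<^sub>C e j))"
      by (rule \<Phi>(3)[OF fin])
    also have "(\<Sum>j<m. b j *\<^sub>C e j) + (\<Sum>j\<in>{m..<N}. b j *\<^sub>C e j) = (\<Sum>j<N. b j *\<^sub>C e j)"
      using sum.atLeastLessThan_concat[of 0 m N "\<lambda>j. b j *\<^sub>C e j"] that by (simp add: atLeast0LessThan)
    finally show ?thesis .
  qed
  moreover have "pos_strict_mono p" using p by (auto simp: pos_strict_mono_def strict_mono_def)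
  moreover have "norm ((T ^^ p k) (e i) - g k (e i)) \<le> (1/2) ^ k / real (Suc k)" if "i \<le> k" for i k
    using conv that by (cases "i = k") auto
  ultimately show ?thesis using e near by (intro exI[of _ e] exI[of _ p]) blast
qed

section \<open>From the left essential spectrum to common convergence\<close>

text \<open>A vector of the span is split after the index \<open>s\<close>. On the head, \<open>R\<close> is close to \<open>h\<close>; on the tail it is
  close to the scalar \<open>a\<close> of modulus at most 1, so that only the norm of the tail enters the error.\<close>

lemma basic_sequence_iterate_bound:
  fixes R h :: "'a::complex_banach \<Rightarrow> 'a"
  assumes R: "bounded_clinear R" and h: "bounded_clinear h"
    and ne: "\<And>i. norm (e i) = 1" and "norm a \<le> 1"
    and basic: "\<And>b m N. m \<le> N \<Longrightarrow> norm (\<Sum>j<m. b j *\<^sub>C e j) \<le> 4 * norm (\<Sum>j<N. b j *\<^sub>C e j)"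
    and high: "\<And>k. s < k \<Longrightarrow> norm (R (e k) - a *\<^sub>C e k) \<le> (1/2) ^ k"
    and low: "\<And>i. i \<le> s \<Longrightarrow> norm (R (e i) - h (e i)) \<le> (1/2) ^ s / real (Suc s)"
    and H: "\<And>x. norm (h x) \<le> H * norm x" and "s < N"
  shows "norm (R (\<Sum>j<N. b j *\<^sub>C e j) - h (\<Sum>j<N. b j *\<^sub>C e j))
    \<le> 16 * (1/2) ^ s * norm (\<Sum>j<N. b j *\<^sub>C e j) + (1 + H) * norm (\<Sum>j\<in>{Suc s..<N}. b j *\<^sub>C e j)"
proof -
  define y where "y = (\<Sum>j<N. b j *\<^sub>C e j)"
  define u where "u = (\<Sum>j<Suc s. b j *\<^sub>C e j)"
  define w where "w = (\<Sum>j\<in>{Suc s..<N}. b j *\<^sub>C e j)"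
  have y: "y = u + w"
    using sum.atLeastLessThan_concat[of 0 "Suc s" N "\<lambda>j. b j *\<^sub>C e j"] \<open>s < N\<close>
    by (simp only: y_def u_def w_def atLeast0LessThan Suc_leI)
  have b: "norm (b j) \<le> 8 * norm y" if "j < N" for j
    unfolding y_def by (rule basic_coefficient_bound[OF ne basic that])
  have "norm (R u - h u) = norm (\<Sum>j<Suc s. b j *\<^sub>C (R (e j) - h (e j)))"
    by (simp only: u_def bounded_clinear_sum[OF R] bounded_clinear_sum[OF h] bounded_clinear_scaleC[OF R]
        bounded_clinear_scaleC[OF h] complex_vector.scale_right_diff_distrib sum_subtractf)
  also have "\<dots> \<le> (\<Sum>j<Suc s. 8 * norm y * ((1/2) ^ s / real (Suc s)))"
  proof (rule sum_norm_le)
    fix j assume "j \<in> {..<Suc s}"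
    then show "norm (b j *\<^sub>C (R (e j) - h (e j))) \<le> 8 * norm y * ((1/2) ^ s / real (Suc s))"
      unfolding norm_scaleC using b[of j] low[of j] \<open>s < N\<close> by (intro mult_mono) auto
  qed
  also have "\<dots> = 8 * norm y * (1/2) ^ s" by simp
  finally have 1: "norm (R u - h u) \<le> 8 * norm y * (1/2) ^ s" .
  have "norm (R w - a *\<^sub>C w) = norm (\<Sum>j\<in>{Suc s..<N}. b j *\<^sub>C (R (e j) - a *\<^sub>C e j))"
    by (simp add: w_def bounded_clinear_sum[OF R] bounded_clinear_scaleC[OF R] complex_vector.scale_sum_right
        complex_vector.scale_right_diff_distrib sum_subtractf scaleC_scaleC mult.commute)
  also have "\<dots> \<le> (\<Sum>j\<in>{Suc s..<N}. 8 * norm y * (1/2) ^ j)"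
  proof (rule sum_norm_le)
    fix j assume "j \<in> {Suc s..<N}"
    then show "norm (b j *\<^sub>C (R (e j) - a *\<^sub>C e j)) \<le> 8 * norm y * (1/2) ^ j"
      unfolding norm_scaleC using b[of j] high[of j] by (intro mult_mono) auto
  qed
  also have "\<dots> = 8 * norm y * (\<Sum>j\<in>{Suc s..<N}. (1/2) ^ j)" by (rule sum_distrib_left[symmetric])
  also have "\<dots> \<le> 8 * norm y * (1/2) ^ s"
  proof -
    have "(\<Sum>j\<in>{Suc s..<N}. (1/2 :: real) ^ j) + 2 * (1/2) ^ N = (1/2) ^ s" using Suc_leI[OF \<open>s < N\<close>]
      by (induction N rule: dec_induct) simp_all
    then have "(\<Sum>j\<in>{Suc s..<N}. (1/2 :: real) ^ j) \<le> (1/2) ^ s"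
      using zero_le_power[of "1/2 :: real" N] by linarith
    then show ?thesis by (intro mult_left_mono) auto
  qed
  finally have 2: "norm (R w - a *\<^sub>C w) \<le> 8 * norm y * (1/2) ^ s" .
  have "norm (a *\<^sub>C w - h w) \<le> norm a * norm w + norm (h w)"
    using norm_triangle_ineq4[of "a *\<^sub>C w" "h w"] by (simp add: norm_scaleC)
  also have "\<dots> \<le> 1 * norm w + H * norm w"
    using \<open>norm a \<le> 1\<close> H by (intro add_mono mult_right_mono) auto
  finally have 3: "norm (a *\<^sub>C w - h w) \<le> (1 + H) * norm w" by (simp add: algebra_simps)
  have "R y - h y = (R u - h u) + ((R w - a *\<^sub>C w) + (a *\<^sub>C w - h w))"
    by (simp add: y bounded_clinear_add[OF R] bounded_clinear_add[OF h])
  then have "norm (R y - h y) \<le> norm (R u - h u) + (norm (R w - a *\<^sub>C w) + norm (a *\<^sub>C w - h w))"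
    by (simp only:) (intro norm_triangle_le add_left_mono norm_triangle_ineq)
  also have "\<dots> \<le> 8 * norm y * (1/2) ^ s + (8 * norm y * (1/2) ^ s + (1 + H) * norm w)"
    by (intro add_mono 1 2 3)
  also have "\<dots> = 16 * (1/2) ^ s * norm y + (1 + H) * norm w" by simp
  finally show ?thesis unfolding y_def w_def .
qed

lemma common_convergence_subspace:
  fixes T :: "'a::complex_banach \<Rightarrow> 'a"
  assumes sep: "separable_space (euclidean :: 'a topology)" and T: "bounded_clinear T"
    and z: "norm z \<le> 1" "\<not> left_Fredholm (\<lambda>x. T x - z *\<^sub>C x)"
    and g: "\<And>l. g l \<in> Omega_ops T"
  shows "\<exists>\<psi> M. inf_dim_closed_csubspace M \<and> (\<forall>l :: nat. pos_strict_mono (\<lambda>n. \<psi> n l) \<and>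
    (\<forall>x\<in>M. (\<lambda>n. (T ^^ \<psi> n l) x) \<longlonglongrightarrow> g l x) \<and>
    (\<exists>C. \<forall>n. \<forall>x\<in>M. norm ((T ^^ \<psi> n l) x) \<le> C * norm x))"
proof -
  have gb: "bounded_clinear (g l)" for l using g[of l] by (simp add: Omega_ops_def cont_clinear_ops_iff)
  have Tn: "bounded_clinear (T ^^ n)" for n by (rule bounded_clinear_funpow[OF T])
  obtain D :: "'a set" and \<omega> :: "nat \<Rightarrow> nat \<Rightarrow> nat" where D: "csubspace D" "closure D = UNIV"
    and \<omega>: "\<And>l. pos_strict_mono (\<omega> l)" "\<And>l x. x \<in> D \<Longrightarrow> (\<lambda>n. (T ^^ \<omega> l n) x) \<longlonglongrightarrow> g l x"
    using common_dense_subspace[where g = g, OF sep T g] by blast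
  \<comment> \<open>Stage \<open>k\<close> of the construction serves the operator \<open>g (idx k)\<close>; each index is served infinitely often.\<close>
  define idx where "idx k = fst (prod_decode k)" for k
  have "strict_mono (\<omega> (idx k))" for k using \<omega>(1) by (simp add: pos_strict_mono_def)
  from adapted_basic_sequence[where \<psi> = "\<lambda>k. \<omega> (idx k)" and g = "\<lambda>k. g (idx k)",
      OF T z(2) D this \<omega>(2)]
  obtain e :: "nat \<Rightarrow> 'a" and p :: "nat \<Rightarrow> nat" where e: "\<And>i. norm (e i) = 1" and p: "pos_strict_mono p"
    and basic: "\<And>b m N. m \<le> N \<Longrightarrow> norm (\<Sum>j<m. b j *\<^sub>C e j) \<le> 4 * norm (\<Sum>j<N. b j *\<^sub>C e j)"
    and high: "\<And>i k. i < k \<Longrightarrow> norm ((T ^^ p i) (e k) - z ^ p i *\<^sub>C e k) \<le> (1/2) ^ k"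
    and low: "\<And>i k. i \<le> k \<Longrightarrow> norm ((T ^^ p k) (e i) - g (idx k) (e i)) \<le> (1/2) ^ k / real (Suc k)"
    by blast
  have coeff: "norm (b i) \<le> 8 * norm (\<Sum>j<N. b j *\<^sub>C e j)" if "i < N" for b i N
    by (rule basic_coefficient_bound[OF e basic that])
  define W where "W = cspan (range e)"
  define M where "M = closure W"
  have csW: "csubspace W" unfolding W_def by (rule complex_vector.subspace_span)
  have "range e \<subseteq> M"
    unfolding M_def W_def by (rule subset_trans[OF complex_vector.span_superset closure_subset])
  then have M: "inf_dim_closed_csubspace M"
    unfolding inf_dim_closed_csubspace_def
    using basic_sequence_not_cfinite_dim[OF e coeff] csubspace_closure[OF csW] by (simp add: M_def)
  have za: "norm (z ^ n) \<le> 1" for n using z(1) by (simp add: norm_power power_le_one)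
  have "\<exists>H\<ge>0. \<forall>x. norm (g l x) \<le> H * norm x" for l
    using bounded_clinear_bounded[OF gb[of l]] by (metis less_imp_le mult.commute)
  then obtain H where H: "\<And>l. H l \<ge> 0" "\<And>l x. norm (g l x) \<le> H l * norm x" by metis
  define A where "A s x = (T ^^ p s) x - g (idx s) x" for s x
  have A: "bounded_clinear (A s)" for s
    unfolding A_def by (rule bounded_clinear_diff_op[OF Tn gb])
  have est: "norm (A s (\<Sum>j<N. b j *\<^sub>C e j)) \<le> 16 * (1/2) ^ s * norm (\<Sum>j<N. b j *\<^sub>C e j)
      + (1 + H (idx s)) * norm (\<Sum>j\<in>{Suc s..<N}. b j *\<^sub>C e j)" if "s < N" for s N b
    unfolding A_def
    by (rule basic_sequence_iterate_bound[OF Tn gb e za basic high low H(2) that])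
  have bd: "norm (A s y) \<le> (16 + 5 * (1 + H (idx s))) * norm y" if y: "y \<in> W" for s y
  proof -
    obtain b N where b: "\<And>n. n \<ge> N \<Longrightarrow> y = (\<Sum>i<n. b i *\<^sub>C e i)"
      using cspan_range_expansion[OF y[unfolded W_def]] by metis
    define n where "n = max N (Suc s)"
    have n: "y = (\<Sum>i<n. b i *\<^sub>C e i)" "s < n" using b[of n] by (auto simp: n_def)
    have "(\<Sum>j\<in>{Suc s..<n}. b j *\<^sub>C e j) = y - (\<Sum>j<Suc s. b j *\<^sub>C e j)"
      using sum.atLeastLessThan_concat[of 0 "Suc s" n "\<lambda>j. b j *\<^sub>C e j"] n
      by (simp add: atLeast0LessThan algebra_simps)
    then have "norm (\<Sum>j\<in>{Suc s..<n}. b j *\<^sub>C e j) \<le> norm y + norm (\<Sum>j<Suc s. b j *\<^sub>C e j)"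
      using norm_triangle_ineq4 by metis
    also have "norm (\<Sum>j<Suc s. b j *\<^sub>C e j) \<le> 4 * norm y" unfolding n(1) using n(2) by (intro basic) simp
    finally have tail: "norm (\<Sum>j\<in>{Suc s..<n}. b j *\<^sub>C e j) \<le> 5 * norm y" by simp
    have "norm (A s y) \<le> 16 * (1/2) ^ s * norm y + (1 + H (idx s)) * norm (\<Sum>j\<in>{Suc s..<n}. b j *\<^sub>C e j)"
      using est[OF n(2), of b] unfolding n(1)[symmetric] .
    also have "\<dots> \<le> 16 * norm y + (1 + H (idx s)) * (5 * norm y)"
    proof (rule add_mono)
      have "16 * (1/2 :: real) ^ s \<le> 16" by (simp add: power_le_one)
      then show "16 * (1/2) ^ s * norm y \<le> 16 * norm y" by (intro mult_right_mono) auto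
      show "(1 + H (idx s)) * norm (\<Sum>j\<in>{Suc s..<n}. b j *\<^sub>C e j) \<le> (1 + H (idx s)) * (5 * norm y)"
        using tail H(1)[of "idx s"] by (intro mult_left_mono) auto
    qed
    finally show ?thesis by (simp add: algebra_simps)
  qed
  have null: "(\<lambda>s. A s y) \<longlonglongrightarrow> 0" if y: "y \<in> W" for y
  proof -
    obtain b N where b: "\<And>i. i \<ge> N \<Longrightarrow> b i = 0" "\<And>n. n \<ge> N \<Longrightarrow> y = (\<Sum>i<n. b i *\<^sub>C e i)"
      using cspan_range_expansion[OF y[unfolded W_def]] by metis
    have "norm (A s y) \<le> 16 * (1/2) ^ s * norm y" if "s \<ge> N" for s
    proof -
      have "(\<Sum>j\<in>{Suc s..<Suc s}. b j *\<^sub>C e j) = 0" by simp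
      then show ?thesis using est[of s "Suc s" b] b(2)[of "Suc s"] that by simp
    qed
    then have "(\<lambda>s. A s y) \<longlonglongrightarrow> 0"
      by (intro Lim_null_comparison[of "\<lambda>s. A s y" "\<lambda>s. 16 * (1/2) ^ s * norm y"])
        (auto simp: eventually_sequentially intro!: tendsto_mult_left_zero tendsto_mult_right_zero LIMSEQ_power_zero)
    then show ?thesis .
  qed
  define \<psi> where "\<psi> n l = p (prod_encode (l, n))" for n l
  have idx: "idx (prod_encode (l, n)) = l" for l n by (simp add: idx_def)
  have sm: "strict_mono (\<lambda>n. prod_encode (l, n))" for l
    by (simp add: strict_mono_Suc_iff prod_encode_def)
  have "pos_strict_mono (\<lambda>n. \<psi> n l)" for l
    using p sm[of l] by (auto simp: pos_strict_mono_def \<psi>_def strict_mono_def)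
  moreover have conv: "norm (A (prod_encode (l, n)) x) \<le> (16 + 5 * (1 + H l)) * norm x"
    "(\<lambda>n. A (prod_encode (l, n)) x) \<longlonglongrightarrow> 0" if "x \<in> M" for x l n
  proof -
    have 1: "norm (A (prod_encode (l, n)) y) \<le> (16 + 5 * (1 + H l)) * norm y" if "y \<in> W" for n y
      using bd[OF that, of "prod_encode (l, n)"] by (simp only: idx)
    have 2: "(\<lambda>n. A (prod_encode (l, n)) y) \<longlonglongrightarrow> 0" if "y \<in> W" for y
      using LIMSEQ_subseq_LIMSEQ[OF null[OF that] sm[of l]] by (simp add: comp_def)
    have x: "x \<in> closure W" using that by (simp add: M_def)
    note null' = bounded_clinear_null_on_closure[where A = "\<lambda>n. A (prod_encode (l, n))" and W = W
        and C = "16 + 5 * (1 + H l)", OF A 1 2 csW x]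
    show "norm (A (prod_encode (l, n)) x) \<le> (16 + 5 * (1 + H l)) * norm x" by (rule null'(1))
    show "(\<lambda>n. A (prod_encode (l, n)) x) \<longlonglongrightarrow> 0" by (rule null'(2))
  qed
  have "(\<lambda>n. (T ^^ \<psi> n l) x) \<longlonglongrightarrow> g l x" if "x \<in> M" for x l
    using conv(2)[OF that, of l] by (simp add: A_def idx \<psi>_def LIM_zero_iff)
  moreover have "\<exists>C. \<forall>n. \<forall>x\<in>M. norm ((T ^^ \<psi> n l) x) \<le> C * norm x" for l
  proof (intro exI allI ballI)
    fix n x assume "x \<in> M"
    have "(T ^^ \<psi> n l) x = A (prod_encode (l, n)) x + g l x" by (simp add: A_def idx \<psi>_def)
    then have "norm ((T ^^ \<psi> n l) x) \<le> norm (A (prod_encode (l, n)) x) + norm (g l x)"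
      by (metis norm_triangle_ineq)
    also have "\<dots> \<le> (16 + 5 * (1 + H l)) * norm x + H l * norm x"
      by (intro add_mono conv(1)[OF \<open>x \<in> M\<close>] H(2))
    finally show "norm ((T ^^ \<psi> n l) x) \<le> ((16 + 5 * (1 + H l)) + H l) * norm x"
      by (simp add: algebra_simps)
  qed
  ultimately show ?thesis using M by (intro exI[of _ \<psi>] exI[of _ M]) blast
qed

lemma filterlim_subseq_not_bounded:
  fixes a :: "nat \<Rightarrow> real" and r :: "nat \<Rightarrow> nat"
  assumes "filterlim a at_top sequentially" "strict_mono r"
  shows "\<not> (\<forall>n. a (r n) \<le> B)"
proof
  assume "\<forall>n. a (r n) \<le> B"
  moreover have "filterlim (\<lambda>n. a (r n)) at_top sequentially"
    using assms filterlim_subseq filterlim_compose by blast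
  then have "\<forall>\<^sub>F n in sequentially. B < a (r n)" unfolding filterlim_at_top_dense by blast
  then obtain n where "B < a (r n)" unfolding eventually_sequentially by blast
  ultimately show False by (simp add: not_le[symmetric])
qed


theorem theorem4p10:
  fixes T :: "'a::complex_banach \<Rightarrow> 'a"
  assumes "separable_space (euclidean :: 'a topology)"
    and "\<not> cfinite_dim (UNIV :: 'a set)"
    and "T \<in> cont_clinear_ops"
    and "Omega_ops T \<noteq> {}"
  shows
    "let
       A1 = (\<exists>g \<in> cont_clinear_ops. spaceable (R_set T g));
       A2 = (\<forall>g :: nat \<Rightarrow> 'a \<Rightarrow> 'a. (\<forall>l. g l \<in> Omega_ops T) \<longrightarrow>
              (\<exists>(\<psi> :: nat \<Rightarrow> nat \<Rightarrow> nat) M.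
                 (\<forall>l. pos_strict_mono (\<lambda>n. \<psi> n l)) \<and>
                 inf_dim_closed_csubspace M \<and>
                 (\<forall>x \<in> M. \<forall>l. (\<lambda>n. (T ^^ \<psi> n l) x) \<longlonglongrightarrow> g l x)));
       A3 = (\<exists>\<theta> E. pos_strict_mono \<theta> \<and> inf_dim_closed_csubspace E \<and>
              bdd_above (range (\<lambda>n. onorm_on E (T ^^ \<theta> n))));
       A4 = (left_essential_spectrum T \<inter> cball 0 1 \<noteq> {})
     in (A1 \<longleftrightarrow> A2) \<and> (A2 \<longleftrightarrow> A3) \<and> (A3 \<longleftrightarrow> A4)"
proof -
  have T: "bounded_clinear T" using assms(3) by (simp add: cont_clinear_ops_iff)
  obtain h where h: "h \<in> Omega_ops T" using assms(4) by blast
  define A1 where "A1 \<longleftrightarrow> (\<exists>g \<in> cont_clinear_ops. spaceable (R_set T g))"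
  define A2 where "A2 \<longleftrightarrow> (\<forall>g :: nat \<Rightarrow> 'a \<Rightarrow> 'a. (\<forall>l. g l \<in> Omega_ops T) \<longrightarrow>
              (\<exists>(\<psi> :: nat \<Rightarrow> nat \<Rightarrow> nat) M.
                 (\<forall>l. pos_strict_mono (\<lambda>n. \<psi> n l)) \<and>
                 inf_dim_closed_csubspace M \<and>
                 (\<forall>x \<in> M. \<forall>l. (\<lambda>n. (T ^^ \<psi> n l) x) \<longlonglongrightarrow> g l x)))"
  define A3 where "A3 \<longleftrightarrow> (\<exists>\<theta> E. pos_strict_mono \<theta> \<and> inf_dim_closed_csubspace E \<and>
              bdd_above (range (\<lambda>n. onorm_on E (T ^^ \<theta> n))))"
  define A4 where "A4 \<longleftrightarrow> left_essential_spectrum T \<inter> cball 0 1 \<noteq> {}"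
  have escape: "\<exists>x\<in>M. filterlim (\<lambda>n. norm ((T ^^ n) x)) at_top sequentially"
    if "\<not> A4" "inf_dim_closed_csubspace M" for M
  proof -
    have "left_Fredholm (\<lambda>x. T x - z *\<^sub>C x)" if "norm z \<le> 1" for z
      using \<open>\<not> A4\<close> that by (auto simp: A4_def left_essential_spectrum_def)
    then show ?thesis using orbit_tends_to_infinity[OF T _ that(2)] by metis
  qed
  have "A4 \<Longrightarrow> A2"
  proof -
    assume A4
    then obtain z where z: "norm z \<le> 1" "\<not> left_Fredholm (\<lambda>x. T x - z *\<^sub>C x)"
      by (auto simp: A4_def left_essential_spectrum_def)
    show A2
      unfolding A2_def
    proof (intro allI impI)
      fix g :: "nat \<Rightarrow> 'a \<Rightarrow> 'a" assume g: "\<forall>l. g l \<in> Omega_ops T"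
      show "\<exists>(\<psi> :: nat \<Rightarrow> nat \<Rightarrow> nat) M. (\<forall>l. pos_strict_mono (\<lambda>n. \<psi> n l)) \<and>
          inf_dim_closed_csubspace M \<and> (\<forall>x \<in> M. \<forall>l. (\<lambda>n. (T ^^ \<psi> n l) x) \<longlonglongrightarrow> g l x)"
        using common_convergence_subspace[where g = g, OF assms(1) T z g[rule_format]] by blast
    qed
  qed
  moreover have "A4 \<Longrightarrow> A3"
  proof -
    assume A4
    then obtain z where z: "norm z \<le> 1" "\<not> left_Fredholm (\<lambda>x. T x - z *\<^sub>C x)"
      by (auto simp: A4_def left_essential_spectrum_def)
    obtain \<psi> :: "nat \<Rightarrow> nat \<Rightarrow> nat" and M :: "'a set" where M: "inf_dim_closed_csubspace M"
      and \<psi>: "\<And>l. pos_strict_mono (\<lambda>n. \<psi> n l)"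
        "\<And>l. \<exists>C. \<forall>n. \<forall>x\<in>M. norm ((T ^^ \<psi> n l) x) \<le> C * norm x"
      using common_convergence_subspace[where g = "\<lambda>_. h", OF assms(1) T z h] by blast
    obtain C where C: "\<And>n x. x \<in> M \<Longrightarrow> norm ((T ^^ \<psi> n 0) x) \<le> C * norm x"
      using \<psi>(2)[of 0] by blast
    have "M \<noteq> {}" using M complex_vector.subspace_0 unfolding inf_dim_closed_csubspace_def by blast
    have "onorm_on M (T ^^ \<psi> n 0) \<le> max C 0" for n
      unfolding onorm_on_def
    proof (rule cSUP_least[OF \<open>M \<noteq> {}\<close>])
      fix x assume "x \<in> M"
      show "norm ((T ^^ \<psi> n 0) x) / norm x \<le> max C 0"
      proof (cases "x = 0")
        case False
        then show ?thesis using C[OF \<open>x \<in> M\<close>, of n] by (simp add: divide_le_eq le_max_iff_disj)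
      qed simp
    qed
    then have "bdd_above (range (\<lambda>n. onorm_on M (T ^^ \<psi> n 0)))" by (rule bdd_aboveI2)
    then show A3 unfolding A3_def using \<psi>(1) M by (intro exI[of _ "\<lambda>n. \<psi> n 0"] exI[of _ M]) blast
  qed
  moreover have "A2 \<Longrightarrow> A1"
  proof -
    assume A2
    from this[unfolded A2_def, rule_format, of "\<lambda>_. h"] h
    obtain \<psi> :: "nat \<Rightarrow> nat \<Rightarrow> nat" and M :: "'a set" where M: "inf_dim_closed_csubspace M"
      "pos_strict_mono (\<lambda>n. \<psi> n 0)" "\<And>x. x \<in> M \<Longrightarrow> (\<lambda>n. (T ^^ \<psi> n 0) x) \<longlonglongrightarrow> h x" by blast
    then have "M \<subseteq> R_set T h" unfolding R_set_def by blast
    then have "spaceable (R_set T h)" using M(1) by (auto simp: spaceable_def)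
    then show A1 using h by (auto simp: A1_def Omega_ops_def)
  qed
  moreover have "A1 \<Longrightarrow> A4"
  proof (rule ccontr)
    assume A1 and "\<not> A4"
    then obtain g M where M: "inf_dim_closed_csubspace M" "M \<subseteq> R_set T g \<union> {0}"
      by (auto simp: A1_def spaceable_def)
    obtain x where x: "x \<in> M" "filterlim (\<lambda>n. norm ((T ^^ n) x)) at_top sequentially"
      using escape[OF \<open>\<not> A4\<close> M(1)] by blast
    have "\<exists>(r :: nat \<Rightarrow> nat) B. strict_mono r \<and> (\<forall>n. norm ((T ^^ r n) x) \<le> B)"
    proof (cases "x = 0")
      case True
      then show ?thesis
        by (intro exI[of _ id] exI[of _ 0])
          (simp add: bounded_clinear_zero[OF bounded_clinear_funpow[OF T]] strict_mono_def)
    next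
      case False
      then obtain r where r: "pos_strict_mono r" "(\<lambda>n. (T ^^ r n) x) \<longlonglongrightarrow> g x"
        using x(1) M(2) by (auto simp: R_set_def)
      have "Bseq (\<lambda>n. (T ^^ r n) x)" using r(2) by (intro convergent_imp_Bseq convergentI)
      then show ?thesis using r(1) by (auto simp: Bseq_def pos_strict_mono_def)
    qed
    then show False using filterlim_subseq_not_bounded[OF x(2)] by blast
  qed
  moreover have "A3 \<Longrightarrow> A4"
  proof (rule ccontr)
    assume A3 and "\<not> A4"
    then obtain \<theta> E where E: "pos_strict_mono \<theta>" "inf_dim_closed_csubspace E"
      "bdd_above (range (\<lambda>n. onorm_on E (T ^^ \<theta> n)))" by (auto simp: A3_def)
    obtain B where B: "\<And>n. onorm_on E (T ^^ \<theta> n) \<le> B" using E(3) by (auto simp: bdd_above_def)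
    obtain x where x: "x \<in> E" "filterlim (\<lambda>n. norm ((T ^^ n) x)) at_top sequentially"
      using escape[OF \<open>\<not> A4\<close> E(2)] by blast
    have "norm ((T ^^ \<theta> n) x) \<le> B * norm x" for n
    proof -
      have Tn: "bounded_clinear (T ^^ \<theta> n)" by (rule bounded_clinear_funpow[OF T])
      obtain K where K: "K > 0" "\<And>y. norm ((T ^^ \<theta> n) y) \<le> norm y * K"
        using bounded_clinear_bounded[OF Tn] by blast
      have "norm ((T ^^ \<theta> n) y) / norm y \<le> K" for y
        using K by (cases "y = 0") (simp_all add: divide_le_eq mult.commute)
      then have "bdd_above ((\<lambda>y. norm ((T ^^ \<theta> n) y) / norm y) ` E)" by (rule bdd_aboveI2)
      then have "norm ((T ^^ \<theta> n) x) / norm x \<le> onorm_on E (T ^^ \<theta> n)"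
        unfolding onorm_on_def by (rule cSUP_upper[OF x(1)])
      also note B[of n]
      finally show ?thesis
        by (cases "x = 0") (simp_all add: divide_le_eq bounded_clinear_zero[OF Tn])
    qed
    moreover have "strict_mono \<theta>" using E(1) by (simp add: pos_strict_mono_def)
    ultimately show False using filterlim_subseq_not_bounded[OF x(2), of \<theta> "B * norm x"] by blast
  qed
  ultimately have "(A1 \<longleftrightarrow> A2) \<and> (A2 \<longleftrightarrow> A3) \<and> (A3 \<longleftrightarrow> A4)" by blast
  then show ?thesis unfolding Let_def A1_def A2_def A3_def A4_def .
qed

end
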